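(* For every integer $n\ge1$, $\mathrm{fp}(n)\le \mathrm{DD}(n)+2$, where $\mathrm{fp}(n)$ is the supremum, over all $(b,a,r)\in\mathbb{R}_{>0}\times\mathbb{R}^n\times\mathbb{R}^n$, of the number of connected components of the solution set $$S_n(b,a,r)=\{x\in I_n(a,r)\;:\;a_n+(a_{n-1}+\cdots(a_1+x^{r_1})^{r_2}\cdots)^{r_n}-b\,x=0\},$$ and $\mathrm{DD}(n)$ is the derivation-division number defined in the context.
   Context: For $(a,r)\in\mathbb{R}^n\times\mathbb{R}^n$, $I_n(a,r)\subset\mathbb{R}$ is the (possibly empty) open interval of all real $x$ for which the functions $g_0(x)=x$, $g_{i+1}(x)=a_{i+1}+g_i(x)^{r_{i+1}}$ ($0\le i\le n-1$) are all defined and strictly positive, i.e. $g_0(x),\ldots,g_n(x)>0$. Definition of $\mathrm{DD}(n)$. Fix $n\ge 1$ and let $R=\mathbb{Z}[R_1,\ldots,R_n]$ (polynomial ring). For $0\le j\le n$ let $\mathbb{L}_j=R[x_1^{\pm},y_1^{\pm},\ldots,x_j^{\pm},y_j^{\pm}]$ be the ring of Laurent polynomials in $x_1,y_1,\ldots,x_j,y_j$ over $R$ ($\mathbb{L}_0=R$). The degree of a monomial $c\,x^ky^l$ ($c\in R\setminus\{0\}$, $k,l\in\mathbb{Z}^j$) is the vector $k+l\in\mathbb{Z}^j$. A nonzero element of $\mathbb{L}_j$ is homogeneous if all its monomials have the same degree, denoted $\mathrm{pdeg}(p)=(\mathrm{pdeg}_1(p),\ldots,\mathrm{pdeg}_j(p))$.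 Put $\Delta_0=1$, $\Delta_i=R_1\cdots R_i$. The derivation $\partial:\mathbb{L}_n\to\mathbb{L}_n$ vanishes on $R$ and satisfies $$\partial(x_1)=\partial(y_1)=\Delta_1x_1,\qquad \partial(x_j)=\partial(y_j)=\Delta_j\,x_j\,\frac{x_1\cdots x_{j-1}}{y_1\cdots y_{j-1}}\quad (j\ge 2).$$ It maps each $\mathbb{L}_j$ to itself, and it maps a homogeneous element either to $0$ or to a homogeneous element of the same degree. Regularization monomial $\mathrm{reg}(p)$ of a nonzero homogeneous $p\in\mathbb{L}_j$, defined by induction on $j$: for $j=0$, $\mathrm{reg}(p)=1$; for $j\ge1$, put $m=\mathrm{pdeg}_j(p)$ and write $p=\sum_{i=n_0}^{n_1}q_i\,x_j^{i}y_j^{m-i}$ with integers $n_0\le n_1$ (possibly negative), $q_i\in\mathbb{L}_{j-1}$ zero or homogeneous, $q_{n_0}\ne0$, $q_{n_1}\neq 0$; then $\mathrm{reg}(p)=x_j^{n_0}y_j^{m-n_1}\,\mathrm{reg}(q_{n_0})$. Derivation-division sequence: for a nonzero homogeneous $p$, set $p^{(0)}=p$ and $p^{(k+1)}=\partial p^{(k)}/\mathrm{reg}(\partial p^{(k)})$ if $\partial p^{(k)}\ne0$, and $p^{(k+1)}=0$ if $\partial p^{(k)}=0$. $\mathrm{DD}(p)$ is the smallest integer $k\ge0$ with $p^{(k)}\in R$. Finally $\mathrm{DD}(n):=\mathrm{DD}(p)$ for the polynomial (for which such a $k$ exists) $$p=\Delta_n\sum_{j=1}^{n}(\Delta_j-\Delta_{j-1})\Big(\prod_{i=1}^{j-1}x_i\Big)\Big(\prod_{i=j}^{n-1}y_i\Big)\in\mathbb{L}_{n-1}.$$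 *)

theory Defs
  imports
    "HOL-Analysis.Analysis"
    "HOL-Library.Extended_Nat"
    "HOL-Library.Poly_Mapping"
    "HOL-Library.Product_Plus"
begin

section \<open>Fixed points of compositions of translations and power maps\<close>

text \<open>
  Vectors of length \<open>n\<close> are functions on \<open>nat\<close> of which only the entries \<open>1, \<dots>, n\<close> are used.
  The exponentiation \<open>powr\<close> is only ever relevant for a positive base: membership in
  \<open>dom_int n a r\<close> forces every \<open>g_seq a r i x\<close> with \<open>i \<le> n\<close> to be positive.
\<close>

fun g_seq :: "(nat \<Rightarrow> real) \<Rightarrow> (nat \<Rightarrow> real) \<Rightarrow> nat \<Rightarrow> real \<Rightarrow> real" where
  "g_seq a r 0 x = x"
| "g_seq a r (Suc i) x = a (Suc i) + g_seq a r i x powr r (Suc i)"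

definition dom_int :: "nat \<Rightarrow> (nat \<Rightarrow> real) \<Rightarrow> (nat \<Rightarrow> real) \<Rightarrow> real set" where
  "dom_int n a r = {x. \<forall>i\<le>n. g_seq a r i x > 0}"

definition sol_set :: "nat \<Rightarrow> real \<Rightarrow> (nat \<Rightarrow> real) \<Rightarrow> (nat \<Rightarrow> real) \<Rightarrow> real set" where
  "sol_set n b a r = {x \<in> dom_int n a r. g_seq a r n x - b * x = 0}"

definition num_components :: "'a::topological_space set \<Rightarrow> enat" where
  "num_components S = (if finite (components S) then enat (card (components S)) else \<infinity>)"

definition fp :: "nat \<Rightarrow> enat" where
  "fp n = Sup {num_components (sol_set n b a r) | b a r. b > 0}"


section \<open>Laurent polynomials\<close>

text \<open>
  A coefficient is a polynomial with integer coefficients in \<open>R\<^sub>1, R\<^sub>2, \<dots>\<close>. A Laurent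
  polynomial is an element of the group algebra, over these coefficients, of the group of
  exponent pairs \<open>(k, l)\<close>, where \<open>(k, l)\<close> stands for the monomial \<open>x\<^sup>k y\<^sup>l\<close>.
  The polynomial ring in \<open>R\<^sub>1, \<dots>, R\<^sub>n\<close> is the carrier \<open>coeff_ring n\<close>, and the Laurent
  polynomials over it in \<open>x\<^sub>1, y\<^sub>1, \<dots>, x\<^sub>j, y\<^sub>j\<close> form the carrier \<open>laurent n j\<close>;
  \<open>laurent n 0\<close> is the coefficient ring embedded as the constants.
\<close>

type_synonym coeff = "(nat \<Rightarrow>\<^sub>0 nat) \<Rightarrow>\<^sub>0 int"
type_synonym expo = "(nat \<Rightarrow>\<^sub>0 int) \<times> (nat \<Rightarrow>\<^sub>0 int)"
type_synonym laur = "expo \<Rightarrow>\<^sub>0 coeff"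

definition coeff_ring :: "nat \<Rightarrow> coeff set" where
  "coeff_ring n = {c. \<forall>m \<in> Poly_Mapping.keys c. Poly_Mapping.keys m \<subseteq> {1..n}}"

definition expos :: "nat \<Rightarrow> expo set" where
  "expos j = {(k, l). Poly_Mapping.keys k \<subseteq> {1..j} \<and> Poly_Mapping.keys l \<subseteq> {1..j}}"

definition laurent :: "nat \<Rightarrow> nat \<Rightarrow> laur set" where
  "laurent n j = {p. \<forall>e \<in> Poly_Mapping.keys p.
     e \<in> expos j \<and> Poly_Mapping.lookup p e \<in> coeff_ring n}"

definition Rvar :: "nat \<Rightarrow> coeff" where
  "Rvar i = Poly_Mapping.single (Poly_Mapping.single i 1) 1"

definition Dlt :: "nat \<Rightarrow> coeff" where
  "Dlt i = (\<Prod>t=1..i. Rvar t)"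

definition const :: "coeff \<Rightarrow> laur" where
  "const c = Poly_Mapping.single 0 c"

definition monom_xy :: "expo \<Rightarrow> laur" where
  "monom_xy e = Poly_Mapping.single e 1"

definition xpow :: "nat \<Rightarrow> int \<Rightarrow> laur" where
  "xpow j m = monom_xy (Poly_Mapping.single j m, 0)"

definition ypow :: "nat \<Rightarrow> int \<Rightarrow> laur" where
  "ypow j m = monom_xy (0, Poly_Mapping.single j m)"


section \<open>The derivation\<close>

definition ddx :: "nat \<Rightarrow> laur \<Rightarrow> laur" where
  "ddx j p = (\<Sum>e \<in> Poly_Mapping.keys p.
     Poly_Mapping.single (e + (Poly_Mapping.single j (-1), 0))
       (of_int (Poly_Mapping.lookup (fst e) j) * Poly_Mapping.lookup p e))"

definition ddy :: "nat \<Rightarrow> laur \<Rightarrow> laur" where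
  "ddy j p = (\<Sum>e \<in> Poly_Mapping.keys p.
     Poly_Mapping.single (e + (0, Poly_Mapping.single j (-1)))
       (of_int (Poly_Mapping.lookup (snd e) j) * Poly_Mapping.lookup p e))"

text \<open>The common value of the derivation at \<open>x\<^sub>j\<close> and \<open>y\<^sub>j\<close>; the product is empty for \<open>j = 1\<close>.\<close>

definition dvar :: "nat \<Rightarrow> laur" where
  "dvar j = const (Dlt j) * xpow j 1 * (\<Prod>i=1..<j. xpow i 1 * ypow i (-1))"

text \<open>
  The derivation of \<open>laurent n n\<close>, given by the chain rule. That it is the unique derivation
  vanishing on the coefficients with the prescribed values at the \<open>x\<^sub>j\<close> and \<open>y\<^sub>j\<close> is
  \<open>is_deriv_dd_deriv\<close> and \<open>is_deriv_unique\<close> below.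
\<close>

definition dd_deriv :: "nat \<Rightarrow> laur \<Rightarrow> laur" where
  "dd_deriv n p = (\<Sum>j=1..n. (ddx j p + ddy j p) * dvar j)"

definition is_deriv :: "nat \<Rightarrow> (laur \<Rightarrow> laur) \<Rightarrow> bool" where
  "is_deriv n D \<longleftrightarrow>
     (\<forall>p \<in> laurent n n. \<forall>q \<in> laurent n n. D (p + q) = D p + D q) \<and>
     (\<forall>p \<in> laurent n n. \<forall>q \<in> laurent n n. D (p * q) = D p * q + p * D q) \<and>
     (\<forall>c \<in> coeff_ring n. D (const c) = 0) \<and>
     (\<forall>j \<in> {1..n}. D (xpow j 1) = dvar j \<and> D (ypow j 1) = dvar j)"

lemma ddx_add: "ddx j (p+q) = ddx j p + ddx j q"
  unfolding ddx_def
  apply (rule setsum_keys_plus_distrib[where f="\<lambda>e c. Poly_Mapping.single (e + (Poly_Mapping.single j (-1), 0))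
       (of_int (Poly_Mapping.lookup (fst e) j) * c)"])
  apply (simp_all add: single_add ring_distribs lookup_add)
  done
lemma ddy_add: "ddy j (p+q) = ddy j p + ddy j q"
  unfolding ddy_def
  apply (rule setsum_keys_plus_distrib[where f="\<lambda>e c. Poly_Mapping.single (e + (0,Poly_Mapping.single j (-1)))
       (of_int (Poly_Mapping.lookup (snd e) j) * c)"])
  apply (simp_all add: single_add ring_distribs lookup_add)
  done
lemma ddx_single: "ddx j (Poly_Mapping.single e c) = Poly_Mapping.single (e + (Poly_Mapping.single j (-1), 0))
       (of_int (Poly_Mapping.lookup (fst e) j) * c)"
  by (cases "c=0") (auto simp: ddx_def)
lemma ddy_single: "ddy j (Poly_Mapping.single e c) = Poly_Mapping.single (e + (0,Poly_Mapping.single j (-1)))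
       (of_int (Poly_Mapping.lookup (snd e) j) * c)"
  by (cases "c=0") (auto simp: ddy_def)

lemma poly_mapping_single_induct [case_names single add]:
  fixes p :: "'b \<Rightarrow>\<^sub>0 'c::comm_monoid_add"
  assumes "\<And>e c. P (Poly_Mapping.single e c)" "\<And>p q. P p \<Longrightarrow> P q \<Longrightarrow> P (p+q)"
  shows "P p"
proof (induction p rule: update_induct)
  case const
  then show ?case using assms(1)[of _ 0] by simp
next
  case (update f a b)
  have "Poly_Mapping.update a b f = f + Poly_Mapping.single a b"
    using update by (intro poly_mapping_eqI) (auto simp: lookup_update lookup_add lookup_single in_keys_iff when_def)
  then show ?case using update assms by simp
qed

lemma ddx_mult_single: "ddx j (p * Poly_Mapping.single e c) = ddx j p * Poly_Mapping.single e c + p * ddx j (Poly_Mapping.single e c)"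
proof (induction p rule: poly_mapping_single_induct)
  case (single d c)
  then show ?case by (simp add: ddx_single mult_single lookup_add ring_distribs single_add[symmetric] add_ac mult_ac del: add_uminus_conv_diff)
next
  case (add p q)
  then show ?case by (simp add: ddx_add ring_distribs)
qed
lemma ddx_mult: "ddx j (p * q) = ddx j p * q + p * ddx j q"
proof (induction q rule: poly_mapping_single_induct)
  case (single d c)
  then show ?case by (rule ddx_mult_single)
next
  case (add p q)
  then show ?case by (simp add: ddx_add ring_distribs)
qed
lemma ddy_mult_single: "ddy j (p * Poly_Mapping.single e c) = ddy j p * Poly_Mapping.single e c + p * ddy j (Poly_Mapping.single e c)"
proof (induction p rule: poly_mapping_single_induct)
  case (single d c)
  then show ?case by (simp add: ddy_single mult_single lookup_add ring_distribs single_add[symmetric] add_ac mult_ac del: add_uminus_conv_diff)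
next
  case (add p q)
  then show ?case by (simp add: ddy_add ring_distribs)
qed
lemma ddy_mult: "ddy j (p * q) = ddy j p * q + p * ddy j q"
proof (induction q rule: poly_mapping_single_induct)
  case (single d c)
  then show ?case by (rule ddy_mult_single)
next
  case (add p q)
  then show ?case by (simp add: ddy_add ring_distribs)
qed

lemma dd_deriv_add: "dd_deriv n (p + q) = dd_deriv n p + dd_deriv n q"
  by (simp add: dd_deriv_def ddx_add ddy_add sum.distrib ring_distribs add_ac)

lemma dd_deriv_mult: "dd_deriv n (p * q) = dd_deriv n p * q + p * dd_deriv n q"
  by (simp add: dd_deriv_def ddx_mult ddy_mult sum.distrib sum_distrib_left ring_distribs ac_simps)

lemma dd_deriv_const: "dd_deriv n (const c) = 0"
  by (simp add: dd_deriv_def const_def ddx_single ddy_single)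

lemma dd_deriv_x: "j \<in> {1..n} \<Longrightarrow> dd_deriv n (xpow j 1) = dvar j"
proof -
  assume j: "j \<in> {1..n}"
  have "(ddx i (xpow j 1) + ddy i (xpow j 1)) * dvar i = (if i = j then dvar j else 0)" for i
    by (simp add: xpow_def monom_xy_def ddx_single ddy_single lookup_single when_def single_add[symmetric] flip: zero_prod_def)
  then show ?thesis using j by (simp add: dd_deriv_def)
qed
lemma dd_deriv_y: "j \<in> {1..n} \<Longrightarrow> dd_deriv n (ypow j 1) = dvar j"
proof -
  assume j: "j \<in> {1..n}"
  have "(ddx i (ypow j 1) + ddy i (ypow j 1)) * dvar i = (if i = j then dvar j else 0)" for i
    by (simp add: ypow_def monom_xy_def ddx_single ddy_single lookup_single when_def single_add[symmetric] flip: zero_prod_def)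
  then show ?thesis using j by (simp add: dd_deriv_def)
qed
theorem is_deriv_dd_deriv: "is_deriv n (dd_deriv n)"
  by (simp add: is_deriv_def dd_deriv_add dd_deriv_mult dd_deriv_const dd_deriv_x dd_deriv_y del: One_nat_def)

lemma monom_xy_mult: "monom_xy (d + e) = monom_xy d * monom_xy e"
  by (simp add: monom_xy_def mult_single)
lemma monom_xy_0: "monom_xy 0 = 1" by (simp add: monom_xy_def)

lemma is_deriv_unique:
  assumes D: "is_deriv n D" and p: "p \<in> laurent n n"
  shows "D p = dd_deriv n p"
proof -
  have add: "D (p + q) = D p + D q" if "p \<in> laurent n n" "q \<in> laurent n n" for p q
    using D that by (auto simp: is_deriv_def)
  have mult: "D (p * q) = D p * q + p * D q" if "p \<in> laurent n n" "q \<in> laurent n n" for p q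
    using D that by (auto simp: is_deriv_def)
  have c: "D (const c) = 0" if "c \<in> coeff_ring n" for c
    using D that by (auto simp: is_deriv_def)
  have one: "1 \<in> coeff_ring n" and zero: "0 \<in> coeff_ring n" by (auto simp: coeff_ring_def)
  have D1: "D 1 = 0" using c[OF one] by (simp add: const_def)
  have D0: "D 0 = 0" using c[OF zero] by (simp add: const_def)
  define G where "G = {e \<in> expos n. D (monom_xy e) = dd_deriv n (monom_xy e)}"
  have d1: "dd_deriv n 1 = 0" using dd_deriv_const[of n 1] by (simp add: const_def)
  have d0: "dd_deriv n 0 = 0" using dd_deriv_const[of n 0] by (simp add: const_def)
  have ml: "monom_xy e \<in> laurent n n" if "e \<in> expos n" for e
    using that one by (auto simp: monom_xy_def laurent_def)
  have e_add: "d + e \<in> expos n" if "d \<in> expos n" "e \<in> expos n" for d e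
    using that keys_add[of "fst d" "fst e"] keys_add[of "snd d" "snd e"] by (fastforce simp: expos_def)
  have e_neg: "- e \<in> expos n" if "e \<in> expos n" for e
    using that by (auto simp: expos_def)
  have G0: "0 \<in> G" by (auto simp: G_def expos_def monom_xy_0 D1 d1 zero_prod_def[symmetric]) (simp add: zero_prod_def)
  have Gadd: "d + e \<in> G" if "d \<in> G" "e \<in> G" for d e
    using that e_add by (auto simp: G_def monom_xy_mult mult ml dd_deriv_mult)
  have Gneg: "- e \<in> G" if "e \<in> G" for e
  proof -
    have e: "e \<in> expos n" "- e \<in> expos n" using that e_neg by (auto simp: G_def)
    have u: "monom_xy (-e) * monom_xy e = 1" using monom_xy_mult[of "-e" e] by (simp add: monom_xy_0)
    have 1: "D (monom_xy (-e)) * monom_xy e + monom_xy (-e) * D (monom_xy e) = 0"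
      using mult[of "monom_xy (-e)" "monom_xy e"] u D1 ml e by simp
    have 2: "dd_deriv n (monom_xy (-e)) * monom_xy e + monom_xy (-e) * dd_deriv n (monom_xy e) = 0"
      using dd_deriv_mult[of n "monom_xy (-e)" "monom_xy e"] u d1 by simp
    have 3: "D (monom_xy e) = dd_deriv n (monom_xy e)"
      using that by (auto simp: G_def)
    have 4: "D (monom_xy (-e)) * monom_xy e = dd_deriv n (monom_xy (-e)) * monom_xy e"
      using trans[OF 1 2[symmetric]] unfolding 3 by (rule add_right_imp_eq)
    have "D (monom_xy (-e)) * (monom_xy (-e) * monom_xy e) = dd_deriv n (monom_xy (-e)) * (monom_xy (-e) * monom_xy e)"
      using arg_cong[OF 4, of "\<lambda>t. monom_xy (-e) * t"] by (simp only: ac_simps)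
    then show ?thesis using e u by (simp add: G_def)
  qed
  have Gnat: "(Poly_Mapping.single j (int m), 0) \<in> G \<and> (0, Poly_Mapping.single j (int m)) \<in> G"
    if j: "j \<in> {1..n}" for j m
  proof (induction m)
    case 0
    show ?case using G0 by (simp add: zero_prod_def)
  next
    case (Suc m)
    have "(Poly_Mapping.single j 1, 0) \<in> G" "(0, Poly_Mapping.single j 1) \<in> G"
      using D j dd_deriv_x[OF j] dd_deriv_y[OF j] by (auto simp: G_def expos_def is_deriv_def xpow_def ypow_def)
    from this(1)[THEN Gadd, of "(Poly_Mapping.single j (int m), 0)"]
      this(2)[THEN Gadd, of "(0, Poly_Mapping.single j (int m))"] Suc
    show ?case by (simp add: single_add)
  qed
  have Gint: "(Poly_Mapping.single j m, 0) \<in> G \<and> (0, Poly_Mapping.single j m) \<in> G"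
    if j: "j \<in> {1..n}" for j m
  proof (cases "m \<ge> 0")
    case True
    then show ?thesis using Gnat[OF j, of "nat m"] by simp
  next
    case False
    then show ?thesis using Gnat[OF j, of "nat (- m)"] Gneg[of "(Poly_Mapping.single j (- m), 0)"]
        Gneg[of "(0, Poly_Mapping.single j (- m))"] by (simp add: single_uminus)
  qed
  have Gx: "Poly_Mapping.keys k \<subseteq> {1..n} \<longrightarrow> (k, 0) \<in> G \<and> (0, k) \<in> G" for k :: "nat \<Rightarrow>\<^sub>0 int"
  proof (induction k rule: update_induct)
    case const
    then show ?case using G0 by (simp add: zero_prod_def)
  next
    case (update f a b)
    have eq: "Poly_Mapping.update a b f = f + Poly_Mapping.single a b"
      using update by (intro poly_mapping_eqI) (auto simp: lookup_update lookup_add lookup_single in_keys_iff when_def)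
    show ?case
    proof
      assume "Poly_Mapping.keys (Poly_Mapping.update a b f) \<subseteq> {1..n}"
      then have a: "a \<in> {1..n}" and f: "Poly_Mapping.keys f \<subseteq> {1..n}" using update by (auto simp: keys_update)
      then show "(Poly_Mapping.update a b f, 0) \<in> G \<and> (0, Poly_Mapping.update a b f) \<in> G"
        using Gint[OF a, of b] update Gadd[of "(f,0)" "(Poly_Mapping.single a b, 0)"] Gadd[of "(0,f)" "(0,Poly_Mapping.single a b)"]
        by (simp add: eq)
    qed
  qed
  have G: "e \<in> G" if "e \<in> expos n" for e
  proof -
    obtain k l where "e = (k, l)" by (cases e)
    with that Gx[of k] Gx[of l] Gadd[of "(k,0)" "(0,l)"] show ?thesis by (auto simp: expos_def)
  qed
  have cl: "const c \<in> laurent n n" if "c \<in> coeff_ring n" for c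
    using that by (auto simp: const_def laurent_def expos_def zero_prod_def)
  have sg: "Poly_Mapping.single e c = const c * monom_xy e" for e c
    by (simp add: const_def monom_xy_def mult_single)
  have "p \<in> laurent n n \<longrightarrow> D p = dd_deriv n p" for p
  proof (induction p rule: update_induct)
    case const
    show ?case by (simp add: D0 d0)
  next
    case (update f a b)
    have eq: "Poly_Mapping.update a b f = f + Poly_Mapping.single a b"
      using update by (intro poly_mapping_eqI) (auto simp: lookup_update lookup_add lookup_single in_keys_iff when_def)
    show ?case
    proof
      assume u: "Poly_Mapping.update a b f \<in> laurent n n"
      then have a: "a \<in> expos n" "b \<in> coeff_ring n" using update by (auto simp: laurent_def keys_update lookup_update)
      have f: "f \<in> laurent n n"
      proof -
        have "e \<in> expos n \<and> Poly_Mapping.lookup f e \<in> coeff_ring n" if "e \<in> Poly_Mapping.keys f" for e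
        proof -
          have "e \<noteq> a" using that update by auto
          then show ?thesis using that u update by (auto simp: laurent_def keys_update lookup_update dest!: bspec[of _ _ e])
        qed
        then show ?thesis by (simp add: laurent_def)
      qed
      have s: "Poly_Mapping.single a b \<in> laurent n n" using a by (auto simp: laurent_def)
      have "D (Poly_Mapping.single a b) = dd_deriv n (Poly_Mapping.single a b)"
        using a G[OF a(1)] unfolding sg by (simp add: mult cl ml c dd_deriv_mult dd_deriv_const G_def)
      then show "D (Poly_Mapping.update a b f) = dd_deriv n (Poly_Mapping.update a b f)"
        using update f s by (simp add: eq add dd_deriv_add)
    qed
  qed
  then show ?thesis using p by blast
qed


section \<open>Homogeneous elements and the regularization monomial\<close>

definition homogeneous :: "laur \<Rightarrow> bool" where
  "homogeneous p \<longleftrightarrow> p \<noteq> 0 \<and> (\<exists>d. \<forall>e \<in> Poly_Mapping.keys p. fst e + snd e = d)"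

definition pdeg :: "laur \<Rightarrow> (nat \<Rightarrow>\<^sub>0 int)" where
  "pdeg p = (THE d. \<forall>e \<in> Poly_Mapping.keys p. fst e + snd e = d)"

text \<open>The coefficient of \<open>x\<^sub>j\<^sup>a y\<^sub>j\<^sup>b\<close>, a Laurent polynomial in the other variables.\<close>

definition xy_coeff :: "nat \<Rightarrow> int \<Rightarrow> int \<Rightarrow> laur \<Rightarrow> laur" where
  "xy_coeff j a b p =
     (\<Sum>e \<in> {e \<in> Poly_Mapping.keys p.
               Poly_Mapping.lookup (fst e) j = a \<and> Poly_Mapping.lookup (snd e) j = b}.
        Poly_Mapping.single (e - (Poly_Mapping.single j a, Poly_Mapping.single j b))
          (Poly_Mapping.lookup p e))"

text \<open>
  \<open>reg_expo j p\<close> is the exponent of the regularization monomial of a homogeneous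
  \<open>p \<in> laurent n j\<close>. With \<open>m = pdeg\<^sub>j p\<close> the \<open>q i\<close> below are the coefficients in
  \<open>p = (\<Sum>i. q i * x\<^sub>j\<^sup>i y\<^sub>j\<^sup>m\<^sup>-\<^sup>i)\<close> (see \<open>homogeneous_expansion\<close>).
  An element of \<open>laurent n i\<close> with \<open>i \<le> j\<close> has the same regularization monomial
  whether it is viewed in \<open>laurent n i\<close> or in \<open>laurent n j\<close>.
\<close>

fun reg_expo :: "nat \<Rightarrow> laur \<Rightarrow> expo" where
  "reg_expo 0 p = 0"
| "reg_expo (Suc j) p =
     (let m = Poly_Mapping.lookup (pdeg p) (Suc j);
          q = (\<lambda>i. xy_coeff (Suc j) i (m - i) p);
          n0 = Min {i. q i \<noteq> 0};
          n1 = Max {i. q i \<noteq> 0}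
      in (Poly_Mapping.single (Suc j) n0, Poly_Mapping.single (Suc j) (m - n1))
           + reg_expo j (q n0))"

definition reg :: "nat \<Rightarrow> laur \<Rightarrow> laur" where
  "reg j p = monom_xy (reg_expo j p)"

text \<open>Division by the monomial \<open>reg j p\<close>, i.e. multiplication by its inverse.\<close>

definition div_reg :: "nat \<Rightarrow> laur \<Rightarrow> laur" where
  "div_reg j p = p * monom_xy (- reg_expo j p)"

lemma div_reg_times_reg: "div_reg j p * reg j p = p"
  by (simp add: div_reg_def reg_def mult.assoc monom_xy_mult[symmetric] monom_xy_0)

lemma homogeneous_pdeg:
  assumes "homogeneous p" "e \<in> Poly_Mapping.keys p"
  shows "fst e + snd e = pdeg p"
proof -
  obtain d where d: "\<forall>e \<in> Poly_Mapping.keys p. fst e + snd e = d"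
    using assms by (auto simp: homogeneous_def)
  then have "pdeg p = d"
    unfolding pdeg_def
  proof (rule the_equality)
    show "d' = d" if "\<forall>e \<in> Poly_Mapping.keys p. fst e + snd e = d'" for d'
      using d[rule_format, OF assms(2)] that[rule_format, OF assms(2)] by simp
  qed
  then show ?thesis using d assms by auto
qed

lemma xy_coeff_times_powers:
  "xy_coeff j a b p * xpow j a * ypow j b =
     (\<Sum>e \<in> {e \<in> Poly_Mapping.keys p.
               Poly_Mapping.lookup (fst e) j = a \<and> Poly_Mapping.lookup (snd e) j = b}.
        Poly_Mapping.single e (Poly_Mapping.lookup p e))"
  by (auto simp: xy_coeff_def sum_distrib_right xpow_def ypow_def monom_xy_def mult_single
      diff_add_eq intro!: sum.cong arg_cong2[where f = Poly_Mapping.single] prod_eqI)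

lemma xy_coeff_eq_0:
  assumes "xy_coeff j a b p = 0" "e \<in> Poly_Mapping.keys p"
  shows "\<not> (Poly_Mapping.lookup (fst e) j = a \<and> Poly_Mapping.lookup (snd e) j = b)"
proof
  assume e: "Poly_Mapping.lookup (fst e) j = a \<and> Poly_Mapping.lookup (snd e) j = b"
  let ?A = "{e \<in> Poly_Mapping.keys p.
               Poly_Mapping.lookup (fst e) j = a \<and> Poly_Mapping.lookup (snd e) j = b}"
  have "(\<Sum>e' \<in> ?A. Poly_Mapping.single e' (Poly_Mapping.lookup p e')) = 0"
    using xy_coeff_times_powers[of j a b p] assms(1) by simp
  then have "(\<Sum>e' \<in> ?A. Poly_Mapping.lookup (Poly_Mapping.single e' (Poly_Mapping.lookup p e')) e) = 0"
    by (metis (no_types, lifting) lookup_sum lookup_zero sum.cong)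
  moreover have "(\<Sum>e' \<in> ?A. Poly_Mapping.lookup (Poly_Mapping.single e' (Poly_Mapping.lookup p e')) e)
      = (\<Sum>e' \<in> ?A. if e' = e then Poly_Mapping.lookup p e else 0)"
    by (intro sum.cong) (auto simp: lookup_single when_def)
  ultimately have "Poly_Mapping.lookup p e = 0"
    using e assms(2) by (simp add: sum.delta)
  then show False using assms(2) by (simp add: in_keys_iff)
qed

lemma homogeneous_expansion:
  fixes j p
  defines "m \<equiv> Poly_Mapping.lookup (pdeg p) j"
  defines "N \<equiv> {i. xy_coeff j i (m - i) p \<noteq> 0}"
  assumes hom: "homogeneous p"
  shows "finite N" "N \<noteq> {}"
    "p = (\<Sum>i = Min N..Max N. xy_coeff j i (m - i) p * xpow j i * ypow j (m - i))"
proof -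
  let ?K = "Poly_Mapping.keys p"
  let ?L = "\<lambda>e::expo. Poly_Mapping.lookup (fst e) j"
  have snd: "Poly_Mapping.lookup (snd e) j = m - ?L e" if "e \<in> ?K" for e
    unfolding m_def homogeneous_pdeg[OF hom that, symmetric] by (simp only: lookup_add add_diff_cancel_left')
  have NK: "N \<subseteq> ?L ` ?K"
  proof
    fix i assume i: "i \<in> N"
    have "{e \<in> ?K. ?L e = i \<and> Poly_Mapping.lookup (snd e) j = m - i} \<noteq> {}"
    proof
      assume "{e \<in> ?K. ?L e = i \<and> Poly_Mapping.lookup (snd e) j = m - i} = {}"
      then have "xy_coeff j i (m - i) p = 0"
        by (simp only: xy_coeff_def sum.empty)
      then show False using i by (simp add: N_def)
    qed
    then show "i \<in> ?L ` ?K" by blast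
  qed
  have KN: "?L e \<in> N" if "e \<in> ?K" for e
    using xy_coeff_eq_0[of j "?L e" "m - ?L e" p e] snd[OF that] that by (auto simp: N_def)
  show fin: "finite N" using NK by (rule finite_subset) simp
  have "?K \<noteq> {}" using hom by (simp only: homogeneous_def keys_eq_empty) blast
  then show "N \<noteq> {}" using KN by blast
  have eq: "{e \<in> ?K. ?L e = i \<and> Poly_Mapping.lookup (snd e) j = m - i} = {e \<in> ?K. ?L e = i}" for i
    by (intro Collect_cong) (metis snd)
  have "(\<Sum>i = Min N..Max N. xy_coeff j i (m - i) p * xpow j i * ypow j (m - i)) =
     (\<Sum>i = Min N..Max N. \<Sum>e \<in> {e \<in> ?K. ?L e = i}. Poly_Mapping.single e (Poly_Mapping.lookup p e))"
    unfolding xy_coeff_times_powers eq ..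
  also have "\<dots> = (\<Sum>e \<in> ?K. Poly_Mapping.single e (Poly_Mapping.lookup p e))"
    using KN fin by (intro sum.group) auto
  also have "\<dots> = p"
    by (intro poly_mapping_eqI)
      (auto simp: lookup_sum lookup_single when_def in_keys_iff sum.delta)
  finally show "p = (\<Sum>i = Min N..Max N. xy_coeff j i (m - i) p * xpow j i * ypow j (m - i))" ..
qed


section \<open>The derivation-division number\<close>

fun dd_seq :: "nat \<Rightarrow> laur \<Rightarrow> nat \<Rightarrow> laur" where
  "dd_seq n p 0 = p"
| "dd_seq n p (Suc k) =
     (let p' = dd_deriv n (dd_seq n p k) in if p' = 0 then 0 else div_reg n p')"

text \<open>
  \<open>laurent n 0\<close> is the ring of constants. The \<open>LEAST\<close> is meaningful only when some member
  of the sequence is constant, as is the case for \<open>dd_poly n\<close>, an element of \<open>laurent n (n - 1)\<close>.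
\<close>

definition DD_of :: "nat \<Rightarrow> laur \<Rightarrow> nat" where
  "DD_of n p = (LEAST k. dd_seq n p k \<in> laurent n 0)"

definition dd_poly :: "nat \<Rightarrow> laur" where
  "dd_poly n = const (Dlt n) *
     (\<Sum>j=1..n. const (Dlt j - Dlt (j - 1)) * (\<Prod>i=1..<j. xpow i 1) * (\<Prod>i=j..<n. ypow i 1))"

definition DD :: "nat \<Rightarrow> nat" where
  "DD n = DD_of n (dd_poly n)"

end

theory Submission
  imports Defs
begin

text \<open>
  Put \<open>x\<^sub>i = g\<^sub>i\<^sub>-\<^sub>1(x) powr r\<^sub>i\<close> and \<open>y\<^sub>i = g\<^sub>i(x)\<close>. Then \<open>x d/dx\<close> acts on Laurent polynomials in
  these functions as the derivation does. For \<open>\<Delta>\<^sub>n > 0\<close> the equation \<open>g\<^sub>n' = b\<close> is equivalent, after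
  taking logarithms, to \<open>h = 0\<close> with \<open>h = ln \<Delta>\<^sub>n - ln b + (\<Sum>i. (r\<^sub>i - 1) ln g\<^sub>i\<^sub>-\<^sub>1)\<close>, and \<open>x h'\<close> is a
  nonvanishing multiple of the value of \<open>dd_poly n\<close>; for \<open>\<Delta>\<^sub>n \<le> 0\<close> the function \<open>g\<^sub>n - b x\<close> is strictly
  decreasing. Division by a monomial does not change zeros, so each step of the
  derivation-division sequence costs at most one component by Rolle's theorem. When the
  sequence reaches a constant, the function one step earlier has at most one zero component
  even if the constant is \<open>0\<close>, because it is then itself constant.

  That the sequence does reach a constant is proved by induction on the number of variables:
  after one step only nonnegative powers of \<open>x\<^sub>j, y\<^sub>j\<close> occur, and the coefficient of the
  pure power of \<open>y\<^sub>j\<close> follows its own sequence until it becomes constant, at which point the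
  degree in \<open>x\<^sub>j, y\<^sub>j\<close> drops.
\<close>


section \<open>Rolle's theorem for components of zero sets\<close>

text \<open>A set of reals is alternating of order \<open>k\<close> iff it has at least \<open>k\<close> components. In this form
  Rolle's theorem applies to components of zero sets as directly as to single zeros.\<close>

definition alternating :: "real set \<Rightarrow> nat \<Rightarrow> bool" where
  "alternating S k \<longleftrightarrow> (\<exists>s t. (\<forall>i<k. s i \<in> S) \<and>
     (\<forall>i. Suc i < k \<longrightarrow> s i < t i \<and> t i < s (Suc i) \<and> t i \<notin> S))"

lemma alternatingI:
  assumes "\<And>i. i < k \<Longrightarrow> s i \<in> S"
    and "\<And>i. Suc i < k \<Longrightarrow> s i < t i \<and> t i < s (Suc i) \<and> t i \<notin> S"
  shows "alternating S k"
  unfolding alternating_def using assms by blast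

lemma alternatingE:
  assumes "alternating S k"
  obtains s t where "\<And>i. i < k \<Longrightarrow> s i \<in> S"
    and "\<And>i. Suc i < k \<Longrightarrow> s i < t i \<and> t i < s (Suc i) \<and> t i \<notin> S"
  using assms unfolding alternating_def by blast

text \<open>Between consecutive zeros \<open>s i\<close> the square of \<open>u\<close> attains a
  positive maximum in the interior, because \<open>t i\<close> is not a zero; there
  \<open>u'\<close> vanishes and \<open>u\<close> does not. Since \<open>u\<close> is zero again at
  \<open>s (Suc i)\<close>, the mean value theorem yields a later point with nonzero derivative,
  which separates the new zeros.\<close>

lemma alternating_rolle:
  fixes u u' :: "real \<Rightarrow> real"
  assumes I: "is_interval I"
    and der: "\<And>x. x \<in> I \<Longrightarrow> (u has_real_derivative u' x) (at x)"
    and alt: "alternating {x \<in> I. u x = 0} (Suc k)"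
  shows "alternating {x \<in> I. u' x = 0} k"
proof -
  from alt obtain s t where st: "\<And>i. i < Suc k \<Longrightarrow> s i \<in> {x \<in> I. u x = 0}"
    "\<And>i. Suc i < Suc k \<Longrightarrow> s i < t i \<and> t i < s (Suc i) \<and> t i \<notin> {x \<in> I. u x = 0}"
    by (rule alternatingE) blast
  have s: "s i \<in> I \<and> u (s i) = 0" if "i \<le> k" for i
    using st(1)[of i] that by simp
  have t: "s i < t i \<and> t i < s (Suc i) \<and> \<not> (t i \<in> I \<and> u (t i) = 0)" if "i < k" for i
    using st(2)[of i] that by simp
  have sub: "x \<in> I" if "i < k" "s i \<le> x" "x \<le> s (Suc i)" for i x
    using I s[of i] s[of "Suc i"] that by (auto simp: is_interval_1)
  have "\<exists>m. s i < m \<and> m < s (Suc i) \<and> u m \<noteq> 0 \<and> u' m = 0" if i: "i < k" for i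
  proof -
    have "isCont u x" if "x \<in> {s i..s (Suc i)}" for x
      using sub[OF i, of x] that by (auto intro: DERIV_isCont[OF der])
    then have "continuous_on {s i..s (Suc i)} (\<lambda>x. (u x)\<^sup>2)"
      by (intro continuous_intros continuous_at_imp_continuous_on) blast
    then obtain m where m: "m \<in> {s i..s (Suc i)}"
      and max: "\<And>x. x \<in> {s i..s (Suc i)} \<Longrightarrow> (u x)\<^sup>2 \<le> (u m)\<^sup>2"
      using continuous_attains_sup[of "{s i..s (Suc i)}" "\<lambda>x. (u x)\<^sup>2"] t[OF i] by fastforce
    have "u (t i) \<noteq> 0" using t[OF i] sub[OF i, of "t i"] by auto
    then have "0 < (u m)\<^sup>2" using max[of "t i"] t[OF i]
      by (smt (verit) atLeastAtMost_iff zero_less_power2)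
    then have um: "u m \<noteq> 0" by auto
    then have lt: "s i < m" "m < s (Suc i)" using m s[of i] s[of "Suc i"] i
      by (auto simp: less_le)
    have "((\<lambda>x. (u x)\<^sup>2) has_real_derivative 2 * u m * u' m) (at m)"
      using m sub[OF i] by (auto intro!: derivative_eq_intros der)
    then have "2 * u m * u' m = 0"
    proof (rule DERIV_local_max)
      show "0 < min (m - s i) (s (Suc i) - m)" using lt by simp
      show "\<forall>y. \<bar>m - y\<bar> < min (m - s i) (s (Suc i) - m) \<longrightarrow> (u y)\<^sup>2 \<le> (u m)\<^sup>2"
        using max by (auto simp: abs_if split: if_splits)
    qed
    then show ?thesis using um lt by auto
  qed
  then obtain s' where s': "\<And>i. i < k \<Longrightarrow> s i < s' i \<and> s' i < s (Suc i) \<and> u (s' i) \<noteq> 0 \<and> u' (s' i) = 0"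
    by metis
  have "\<exists>c. s' i < c \<and> c < s (Suc i) \<and> u' c \<noteq> 0" if i: "i < k" for i
  proof -
    have "\<exists>z>s' i. z < s (Suc i) \<and> u (s (Suc i)) - u (s' i) = (s (Suc i) - s' i) * u' z"
      using s'[OF i] by (intro MVT2) (auto intro!: der sub[OF i])
    then obtain z where z: "z > s' i" "z < s (Suc i)"
      "u (s (Suc i)) - u (s' i) = (s (Suc i) - s' i) * u' z" by blast
    then have "u' z \<noteq> 0" using s[of "Suc i"] s'[OF i] i by auto
    then show ?thesis using z by blast
  qed
  then obtain t' where t': "\<And>i. i < k \<Longrightarrow> s' i < t' i \<and> t' i < s (Suc i) \<and> u' (t' i) \<noteq> 0"
    by metis
  show ?thesis
  proof (rule alternatingI[of k s' _ t'])
    fix i assume i: "i < k"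
    show "s' i \<in> {x \<in> I. u' x = 0}" using s'[OF i] sub[OF i] by auto
  next
    fix i assume i: "Suc i < k"
    show "s' i < t' i \<and> t' i < s' (Suc i) \<and> t' i \<notin> {x \<in> I. u' x = 0}"
      using t'[of i] s'[of "Suc i"] i by auto
  qed
qed

text \<open>The zero set is all of the interval or empty, so two zeros cannot have a non-zero
  between them.\<close>

lemma not_alternating_constant:
  fixes u :: "real \<Rightarrow> real"
  assumes I: "is_interval I" and u: "\<And>x y. x \<in> I \<Longrightarrow> y \<in> I \<Longrightarrow> u x = u y"
  shows "\<not> alternating {x \<in> I. u x = 0} (Suc (Suc k))"
proof
  assume "alternating {x \<in> I. u x = 0} (Suc (Suc k))"
  then obtain s t where st: "\<And>i. i < Suc (Suc k) \<Longrightarrow> s i \<in> {x \<in> I. u x = 0}"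
      "\<And>i. Suc i < Suc (Suc k) \<Longrightarrow> s i < t i \<and> t i < s (Suc i) \<and> t i \<notin> {x \<in> I. u x = 0}"
    by (rule alternatingE) blast
  then have s: "s 0 \<in> I" "s 1 \<in> I" "u (s 0) = 0"
    and t: "s 0 < t 0" "t 0 < s 1" "\<not> (t 0 \<in> I \<and> u (t 0) = 0)"
    using st(1)[of 0] st(1)[of 1] st(2)[of 0] by auto
  have "t 0 \<in> I" using I[unfolded is_interval_1] s(1,2) t(1,2) less_imp_le by blast
  then show False using u[of "t 0" "s 0"] s t by auto
qed

section \<open>From alternating sets to numbers of components\<close>

lemma alternating_mono:
  assumes "alternating S k" "j \<le> k"
  shows "alternating S j"
proof -
  from assms(1) obtain s t where "\<And>i. i < k \<Longrightarrow> s i \<in> S"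
    "\<And>i. Suc i < k \<Longrightarrow> s i < t i \<and> t i < s (Suc i) \<and> t i \<notin> S"
    by (rule alternatingE) blast
  then show ?thesis using assms(2) by (intro alternatingI[of j s S t]) simp_all
qed

text \<open>One point is chosen in each component and the points are sorted. A segment between
  neighbours cannot lie inside \<open>S\<close>: being connected, it would put both into one
  component. Any of its points outside \<open>S\<close> separates them.\<close>

lemma alternating_components:
  assumes F: "F \<subseteq> components S" "finite F"
  shows "alternating S (card F)"
proof -
  obtain f where f: "\<And>C. C \<in> F \<Longrightarrow> f C \<in> C"
    using F in_components_nonempty by (metis subset_iff all_not_in_conv)
  have fS: "f C \<in> S" if "C \<in> F" for C
    using f[OF that] F that in_components_subset by blast
  have same: "C = D" if "C \<in> F" "D \<in> F" "{f C..f D} \<subseteq> S" "f C \<le> f D" for C D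
  proof -
    have disj: "C = D \<or> C \<inter> D = {}"
      using components_eq[of C S D] that F by blast
    have "{f C..f D} \<subseteq> C"
    proof (rule components_maximal[of C S])
      have "f C \<in> C \<inter> {f C..f D}" using f[OF that(1)] that(4) by simp
      then show "C \<inter> {f C..f D} \<noteq> {}" by blast
    qed (use that F in auto)
    then have "f D \<in> C" using that(4) by auto
    then show ?thesis using disj f[OF that(2)] by blast
  qed
  have inj: "inj_on f F"
  proof (rule inj_onI)
    fix C D assume "C \<in> F" "D \<in> F" "f C = f D"
    then show "C = D" using same[of C D] fS[of C] by simp
  qed
  define xs where "xs = sorted_list_of_set (f ` F)"
  have xs: "length xs = card F" "set xs = f ` F" "sorted_wrt (<) xs"
    using F inj by (auto simp: xs_def card_image)
  have "\<exists>t. xs ! i < t \<and> t < xs ! Suc i \<and> t \<notin> S" if i: "Suc i < card F" for i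
  proof -
    obtain C D where CD: "C \<in> F" "D \<in> F" "xs ! i = f C" "xs ! Suc i = f D"
    proof -
      have "xs ! i \<in> f ` F" "xs ! Suc i \<in> f ` F"
        using i xs(1) Suc_lessD[OF i] nth_mem unfolding xs(2)[symmetric] by metis+
      then show ?thesis using that by blast
    qed
    have "xs ! i < xs ! Suc i" using sorted_wrt_nth_less[OF xs(3), of i "Suc i"] i xs(1) by simp
    then have lt: "f C < f D" using CD by simp
    then have "\<not> {f C..f D} \<subseteq> S" using same[of C D] CD by auto
    then obtain t where "t \<in> {f C..f D}" "t \<notin> S" by blast
    moreover have "t \<noteq> f C" "t \<noteq> f D" using fS[OF CD(1)] fS[OF CD(2)] \<open>t \<notin> S\<close> by auto
    ultimately show ?thesis using CD by (intro exI[of _ t]) auto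
  qed
  then obtain t where "\<And>i. Suc i < card F \<Longrightarrow> xs ! i < t i \<and> t i < xs ! Suc i \<and> t i \<notin> S"
    by metis
  moreover have "xs ! i \<in> S" if "i < card F" for i
  proof -
    have "xs ! i \<in> f ` F" using that nth_mem[of i xs] xs(1,2) by simp
    then obtain C where "C \<in> F" "xs ! i = f C" by blast
    then show ?thesis using fS[of C] by simp
  qed
  ultimately show ?thesis by (rule alternatingI[of "card F" "(!) xs" S t, rotated])
qed

lemma num_components_le:
  assumes "\<not> alternating S (Suc N)"
  shows "num_components S \<le> enat N"
proof -
  have *: "card F \<le> N" if "F \<subseteq> components S" "finite F" for F
    using alternating_components[OF that] assms alternating_mono[of S "card F" "Suc N"]
    by (meson not_less_eq_eq)
  have "finite (components S)"
  proof (rule ccontr)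
    assume "infinite (components S)"
    then obtain F where "F \<subseteq> components S" "finite F" "card F = Suc N"
      using infinite_arbitrarily_large by metis
    then show False using *[of F] by simp
  qed
  then show ?thesis using *[of "components S"] by (simp add: num_components_def)
qed

text \<open>Replacing \<open>u'\<close> by any \<open>v\<close> with the same zeros in
  \<open>I\<close> leaves room for division by nonvanishing factors.\<close>

lemma not_alternating_derivative:
  fixes u u' :: "real \<Rightarrow> real"
  assumes I: "is_interval I"
    and der: "\<And>x. x \<in> I \<Longrightarrow> (u has_real_derivative u' x) (at x)"
    and zero: "\<And>x. x \<in> I \<Longrightarrow> u' x = 0 \<longleftrightarrow> v x = 0"
    and v: "\<not> alternating {x \<in> I. v x = 0} k"
  shows "\<not> alternating {x \<in> I. u x = 0} (Suc k)"
proof -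
  have "{x \<in> I. u' x = 0} = {x \<in> I. v x = 0}" using zero by blast
  then show ?thesis using alternating_rolle[OF I der, of k] v by auto
qed

section \<open>Evaluation of Laurent polynomials\<close>

text \<open>One scheme serves two layers: \<open>coeff_eval\<close> for the coefficients and
  \<open>laur_eval\<close> for Laurent polynomials over them. It respects sums and products when
  \<open>\<psi>\<close> does and \<open>\<phi>\<close> turns sums of exponents into
  products.\<close>

definition pm_eval :: "('b::zero \<Rightarrow> real) \<Rightarrow> ('a \<Rightarrow> real) \<Rightarrow> ('a \<Rightarrow>\<^sub>0 'b) \<Rightarrow> real" where
  "pm_eval \<psi> \<phi> p = (\<Sum>e \<in> Poly_Mapping.keys p. \<psi> (Poly_Mapping.lookup p e) * \<phi> e)"

lemma pm_eval_single: "\<psi> 0 = 0 \<Longrightarrow> pm_eval \<psi> \<phi> (Poly_Mapping.single e c) = \<psi> c * \<phi> e"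
  by (cases "c = 0") (auto simp: pm_eval_def)

lemma pm_eval_add:
  fixes \<psi> :: "'b::comm_monoid_add \<Rightarrow> real"
  assumes "\<psi> 0 = 0" "\<And>c d. \<psi> (c + d) = \<psi> c + \<psi> d"
  shows "pm_eval \<psi> \<phi> (p + q) = pm_eval \<psi> \<phi> p + pm_eval \<psi> \<phi> q"
  unfolding pm_eval_def
  by (rule setsum_keys_plus_distrib[where f = "\<lambda>e c. \<psi> c * \<phi> e"])
    (auto simp: assms ring_distribs)

lemma pm_eval_mult:
  fixes \<psi> :: "'b::comm_ring_1 \<Rightarrow> real" and \<phi> :: "'a::comm_monoid_add \<Rightarrow> real"
  assumes \<psi>: "\<psi> 0 = 0" "\<And>c d. \<psi> (c + d) = \<psi> c + \<psi> d" "\<And>c d. \<psi> (c * d) = \<psi> c * \<psi> d"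
    and \<phi>: "\<And>c d. \<phi> (c + d) = \<phi> c * \<phi> d"
  shows "pm_eval \<psi> \<phi> (p * q) = pm_eval \<psi> \<phi> p * pm_eval \<psi> \<phi> q"
proof (induction p rule: poly_mapping_single_induct)
  case (single d c)
  show ?case
  proof (induction q rule: poly_mapping_single_induct)
    case (single d c)
    then show ?case by (simp add: mult_single pm_eval_single \<psi> \<phi>)
  next
    case (add p q)
    then show ?case by (simp add: ring_distribs pm_eval_add \<psi>)
  qed
next
  case (add p q)
  then show ?case by (simp add: ring_distribs pm_eval_add \<psi>)
qed

text \<open>Variables with an index beyond \<open>n\<close> are evaluated at \<open>1\<close>, which makes the evaluations
  compatible with the derivation on all of \<open>laur\<close>.\<close>

definition coeff_eval :: "nat \<Rightarrow> (nat \<Rightarrow> real) \<Rightarrow> coeff \<Rightarrow> real" where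
  "coeff_eval n r = pm_eval of_int (\<lambda>m. \<Prod>i=1..n. r i ^ Poly_Mapping.lookup m i)"

lemma coeff_eval_0 [simp]: "coeff_eval n r 0 = 0"
  and coeff_eval_add [simp]: "coeff_eval n r (c + d) = coeff_eval n r c + coeff_eval n r d"
  and coeff_eval_mult [simp]: "coeff_eval n r (c * d) = coeff_eval n r c * coeff_eval n r d"
  unfolding coeff_eval_def
  by (simp add: pm_eval_def)
    (intro pm_eval_add pm_eval_mult; simp add: lookup_add power_add prod.distrib)+

lemma coeff_eval_1 [simp]: "coeff_eval n r 1 = 1"
proof -
  have "coeff_eval n r (Poly_Mapping.single 0 1) = 1"
    unfolding coeff_eval_def by (subst pm_eval_single) auto
  then show ?thesis by simp
qed

lemma coeff_eval_minus [simp]: "coeff_eval n r (- c) = - coeff_eval n r c"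
  using coeff_eval_add[of n r c "- c"] by simp

lemma coeff_eval_diff [simp]: "coeff_eval n r (c - d) = coeff_eval n r c - coeff_eval n r d"
  using coeff_eval_add[of n r c "- d"] by simp

lemma coeff_eval_of_int [simp]: "coeff_eval n r (of_int k) = of_int k"
proof -
  have "coeff_eval n r (of_nat m) = of_nat m" for m
    by (induction m) auto
  then show ?thesis by (cases k) (auto simp del: of_nat_Suc)
qed

lemma coeff_eval_Rvar: "i \<in> {1..n} \<Longrightarrow> coeff_eval n r (Rvar i) = r i"
proof -
  assume i: "i \<in> {1..n}"
  have "coeff_eval n r (Rvar i) = (\<Prod>j=1..n. r j ^ Poly_Mapping.lookup (Poly_Mapping.single i 1) j)"
    unfolding coeff_eval_def Rvar_def by (subst pm_eval_single) auto
  also have "\<dots> = (\<Prod>j=1..n. if i = j then r i else 1)"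
    by (intro prod.cong) (auto simp: lookup_single when_def)
  finally show ?thesis using i by simp
qed

lemma coeff_eval_Dlt: "i \<le> n \<Longrightarrow> coeff_eval n r (Dlt i) = (\<Prod>t=1..i. r t)"
proof (induction i)
  case (Suc i)
  then show ?case using coeff_eval_Rvar[of "Suc i" n r] by (simp add: Dlt_def)
qed (simp add: Dlt_def)

text \<open>\<open>A i\<close> and \<open>B i\<close> are the logarithms of the values of \<open>x\<^sub>i\<close> and \<open>y\<^sub>i\<close>.\<close>

definition mon_eval :: "nat \<Rightarrow> (nat \<Rightarrow> real) \<Rightarrow> (nat \<Rightarrow> real) \<Rightarrow> expo \<Rightarrow> real" where
  "mon_eval n A B e = exp (\<Sum>i=1..n. of_int (Poly_Mapping.lookup (fst e) i) * A i +
     of_int (Poly_Mapping.lookup (snd e) i) * B i)"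

definition laur_eval :: "nat \<Rightarrow> (nat \<Rightarrow> real) \<Rightarrow> (nat \<Rightarrow> real) \<Rightarrow> (nat \<Rightarrow> real) \<Rightarrow> laur \<Rightarrow> real" where
  "laur_eval n r A B = pm_eval (coeff_eval n r) (mon_eval n A B)"

lemma mon_eval_0 [simp]: "mon_eval n A B 0 = 1"
  by (simp add: mon_eval_def)

lemma mon_eval_add: "mon_eval n A B (d + e) = mon_eval n A B d * mon_eval n A B e"
  by (simp add: mon_eval_def lookup_add ring_distribs exp_add[symmetric] sum.distrib algebra_simps)

lemma mon_eval_x: "j \<in> {1..n} \<Longrightarrow> mon_eval n A B (Poly_Mapping.single j m, 0) = exp (of_int m * A j)"
proof -
  assume j: "j \<in> {1..n}"
  have "(\<Sum>i=1..n. of_int (Poly_Mapping.lookup (Poly_Mapping.single j m) i) * A i) =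
      (\<Sum>i=1..n. if j = i then of_int m * A j else 0)"
    by (intro sum.cong) (auto simp: lookup_single when_def)
  then show ?thesis using j by (simp add: mon_eval_def)
qed

lemma mon_eval_y: "j \<in> {1..n} \<Longrightarrow> mon_eval n A B (0, Poly_Mapping.single j m) = exp (of_int m * B j)"
proof -
  assume j: "j \<in> {1..n}"
  have "(\<Sum>i=1..n. of_int (Poly_Mapping.lookup (Poly_Mapping.single j m) i) * B i) =
      (\<Sum>i=1..n. if j = i then of_int m * B j else 0)"
    by (intro sum.cong) (auto simp: lookup_single when_def)
  then show ?thesis using j by (simp add: mon_eval_def)
qed

lemma laur_eval_single: "laur_eval n r A B (Poly_Mapping.single e c) = coeff_eval n r c * mon_eval n A B e"
  by (simp add: laur_eval_def pm_eval_single)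

lemma laur_eval_add: "laur_eval n r A B (p + q) = laur_eval n r A B p + laur_eval n r A B q"
  by (simp add: laur_eval_def pm_eval_add)

lemma laur_eval_0: "laur_eval n r A B 0 = 0"
  by (simp add: laur_eval_def pm_eval_def)

lemma laur_eval_mult: "laur_eval n r A B (p * q) = laur_eval n r A B p * laur_eval n r A B q"
  unfolding laur_eval_def by (intro pm_eval_mult) (auto simp: mon_eval_add)

lemma laur_eval_const: "laur_eval n r A B (const c) = coeff_eval n r c"
  by (simp add: const_def laur_eval_single)

lemma laur_eval_sum: "laur_eval n r A B (sum f S) = (\<Sum>i\<in>S. laur_eval n r A B (f i))"
  by (induction S rule: infinite_finite_induct) (auto simp: laur_eval_add laur_eval_0)

lemma laur_eval_prod: "laur_eval n r A B (prod f S) = (\<Prod>i\<in>S. laur_eval n r A B (f i))"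
proof (induction S rule: infinite_finite_induct)
  have "laur_eval n r A B 1 = 1"
    using laur_eval_const[of n r A B 1] by (simp add: const_def)
  then show "laur_eval n r A B (prod f {}) = (\<Prod>i\<in>{}. laur_eval n r A B (f i))"
    and "infinite S \<Longrightarrow> laur_eval n r A B (prod f S) = (\<Prod>i\<in>S. laur_eval n r A B (f i))" for S
    by auto
qed (auto simp: laur_eval_mult)

lemma laur_eval_xpow: "j \<in> {1..n} \<Longrightarrow> laur_eval n r A B (xpow j m) = exp (of_int m * A j)"
  by (simp add: xpow_def monom_xy_def laur_eval_single mon_eval_x)

lemma laur_eval_ypow: "j \<in> {1..n} \<Longrightarrow> laur_eval n r A B (ypow j m) = exp (of_int m * B j)"
  by (simp add: ypow_def monom_xy_def laur_eval_single mon_eval_y)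

lemma laur_eval_dvar:
  assumes "j \<in> {1..n}"
  shows "laur_eval n r A B (dvar j) = (\<Prod>t=1..j. r t) * (\<Prod>i=1..<j. exp (A i - B i)) * exp (A j)"
proof -
  have "laur_eval n r A B (\<Prod>i=1..<j. xpow i 1 * ypow i (- 1)) = (\<Prod>i=1..<j. exp (A i - B i))"
    unfolding laur_eval_prod laur_eval_mult using assms
    by (intro prod.cong) (auto simp: laur_eval_xpow laur_eval_ypow exp_diff exp_minus divide_inverse)
  then show ?thesis using assms
    by (simp add: dvar_def laur_eval_mult laur_eval_const coeff_eval_Dlt laur_eval_xpow)
qed

text \<open>Only the exponent zero occurs, so the values of the variables do not matter; a constant
  member of the sequence becomes a constant function of \<open>x\<close>.\<close>

lemma laur_eval_laurent_0:
  assumes "p \<in> laurent n 0"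
  shows "laur_eval n r A B p = laur_eval n r A' B' p"
proof -
  have "e = 0" if "e \<in> Poly_Mapping.keys p" for e
    using assms that by (auto simp: laurent_def expos_def prod_eq_iff)
  then show ?thesis unfolding laur_eval_def pm_eval_def by (intro sum.cong) (metis mon_eval_0)+
qed

text \<open>The last factor is an exponential, so dividing by the regularization monomial preserves
  zeros.\<close>

lemma laur_eval_div_reg:
  "laur_eval n r A B p = laur_eval n r A B (div_reg j p) * mon_eval n A B (reg_expo j p)"
  by (metis div_reg_times_reg laur_eval_mult reg_def monom_xy_def laur_eval_single coeff_eval_1 mult_1)

text \<open>The hypotheses say that \<open>x\<close> times the logarithmic derivative of each
  variable is the value of \<open>dvar i\<close> divided by that variable. Both sides of the claim
  are additive in \<open>p\<close>, and on a monomial the derivation multiplies by the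
  exponent-weighted sum of these quantities.\<close>

lemma laur_eval_deriv:
  assumes A: "\<And>i. i \<in> {1..n} \<Longrightarrow> (A i has_real_derivative A' i) (at x)"
    and B: "\<And>i. i \<in> {1..n} \<Longrightarrow> (B i has_real_derivative B' i) (at x)"
    and A': "\<And>i. i \<in> {1..n} \<Longrightarrow>
      x * A' i = laur_eval n r (\<lambda>i. A i x) (\<lambda>i. B i x) (dvar i) * exp (- A i x)"
    and B': "\<And>i. i \<in> {1..n} \<Longrightarrow>
      x * B' i = laur_eval n r (\<lambda>i. A i x) (\<lambda>i. B i x) (dvar i) * exp (- B i x)"
    and x: "x \<noteq> 0"
  shows "((\<lambda>x. laur_eval n r (\<lambda>i. A i x) (\<lambda>i. B i x) p) has_real_derivative
     laur_eval n r (\<lambda>i. A i x) (\<lambda>i. B i x) (dd_deriv n p) / x) (at x)"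
proof (induction p rule: poly_mapping_single_induct)
  case (add p q)
  then show ?case by (simp add: laur_eval_add dd_deriv_add add_divide_distrib DERIV_add)
next
  case (single e c)
  let ?L = "laur_eval n r (\<lambda>i. A i x) (\<lambda>i. B i x)"
  let ?M = "mon_eval n (\<lambda>i. A i x) (\<lambda>i. B i x)"
  let ?k = "\<lambda>i. of_int (Poly_Mapping.lookup (fst e) i) :: real"
  let ?l = "\<lambda>i. of_int (Poly_Mapping.lookup (snd e) i) :: real"
  have "?L (dd_deriv n (Poly_Mapping.single e c)) =
      (\<Sum>i=1..n. coeff_eval n r c * ?M e * (?k i * (x * A' i) + ?l i * (x * B' i)))"
    unfolding dd_deriv_def laur_eval_sum laur_eval_mult laur_eval_add ddx_single ddy_single
      laur_eval_single mon_eval_add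
    by (intro sum.cong) (simp_all add: mon_eval_x mon_eval_y A' B' algebra_simps)
  also have "\<dots> = x * (coeff_eval n r c * (?M e * (\<Sum>i=1..n. ?k i * A' i + ?l i * B' i)))"
    by (simp add: sum_distrib_left algebra_simps)
  finally have "?L (dd_deriv n (Poly_Mapping.single e c)) / x =
      coeff_eval n r c * (?M e * (\<Sum>i=1..n. ?k i * A' i + ?l i * B' i))"
    using x by simp
  then show ?case unfolding laur_eval_single mon_eval_def
    by (auto intro!: derivative_eq_intros A B sum.cong)
qed

section \<open>Algebra of the derivation\<close>

lemma lookup_xy_coeff:
  "Poly_Mapping.lookup (xy_coeff j a b p) e =
    (if Poly_Mapping.lookup (fst e) j = 0 \<and> Poly_Mapping.lookup (snd e) j = 0
     then Poly_Mapping.lookup p (e + (Poly_Mapping.single j a, Poly_Mapping.single j b)) else 0)"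
proof -
  let ?s = "(Poly_Mapping.single j a, Poly_Mapping.single j b) :: expo"
  let ?E = "{d \<in> Poly_Mapping.keys p.
               Poly_Mapping.lookup (fst d) j = a \<and> Poly_Mapping.lookup (snd d) j = b}"
  have "Poly_Mapping.lookup (xy_coeff j a b p) e =
      (\<Sum>d\<in>?E. if d = e + ?s then Poly_Mapping.lookup p d else 0)"
    unfolding xy_coeff_def lookup_sum
    by (intro sum.cong refl) (auto simp: lookup_single when_def algebra_simps)
  also have "\<dots> = (if e + ?s \<in> ?E then Poly_Mapping.lookup p (e + ?s) else 0)"
    by (simp add: sum.delta)
  finally show ?thesis by (auto simp: lookup_add in_keys_iff)
qed

lemma xy_coeff_add: "xy_coeff j a b (p + q) = xy_coeff j a b p + xy_coeff j a b q"
  by (rule poly_mapping_eqI) (simp add: lookup_xy_coeff lookup_add)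

lemma lookup_mult_monom: "Poly_Mapping.lookup (p * monom_xy d) e = Poly_Mapping.lookup p (e - d)"
proof (induction p rule: poly_mapping_single_induct)
  case (single e' c)
  then show ?case by (auto simp: monom_xy_def mult_single lookup_single when_def algebra_simps)
next
  case (add p q)
  then show ?case by (simp add: ring_distribs lookup_add)
qed


lemma xy_coeff_0: "xy_coeff j a b 0 = 0"
  by (simp add: xy_coeff_def)

lemma xy_coeff_sum: "xy_coeff j a b (sum f S) = (\<Sum>i\<in>S. xy_coeff j a b (f i))"
  by (induction S rule: infinite_finite_induct) (auto simp: xy_coeff_add xy_coeff_0)

lemma keys_mult_monom: "e \<in> Poly_Mapping.keys (p * monom_xy d) \<longleftrightarrow> e - d \<in> Poly_Mapping.keys p"
  by (simp add: in_keys_iff lookup_mult_monom)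

lemma sum_single_keys: "(\<Sum>e \<in> Poly_Mapping.keys p. Poly_Mapping.single e (Poly_Mapping.lookup p e)) = p"
  by (intro poly_mapping_eqI) (auto simp: lookup_sum lookup_single when_def in_keys_iff sum.delta)

section \<open>Closure properties of the coefficient ring, the exponents and the Laurent
  rings\<close>

lemma
  shows coeff_ring_add: "c \<in> coeff_ring n \<Longrightarrow> d \<in> coeff_ring n \<Longrightarrow> c + d \<in> coeff_ring n"
    and coeff_ring_minus: "c \<in> coeff_ring n \<Longrightarrow> - c \<in> coeff_ring n"
    and coeff_ring_mult: "c \<in> coeff_ring n \<Longrightarrow> d \<in> coeff_ring n \<Longrightarrow> c * d \<in> coeff_ring n"
    and coeff_ring_of_int: "of_int k \<in> coeff_ring n"
    and coeff_ring_Rvar: "i \<in> {1..n} \<Longrightarrow> Rvar i \<in> coeff_ring n"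
proof -
  show "c \<in> coeff_ring n \<Longrightarrow> d \<in> coeff_ring n \<Longrightarrow> c + d \<in> coeff_ring n"
    using keys_add[of c d] by (fastforce simp: coeff_ring_def)
  show "c \<in> coeff_ring n \<Longrightarrow> - c \<in> coeff_ring n"
    by (auto simp: coeff_ring_def)
  show "c * d \<in> coeff_ring n" if cd: "c \<in> coeff_ring n" "d \<in> coeff_ring n"
    unfolding coeff_ring_def
  proof safe
    fix m i assume "m \<in> Poly_Mapping.keys (c * d)" and i: "i \<in> Poly_Mapping.keys m"
    then obtain u v where "u \<in> Poly_Mapping.keys c" "v \<in> Poly_Mapping.keys d" "m = u + v"
      using keys_mult[of c d] by blast
    then show "i \<in> {1..n}" using cd i keys_add[of u v] by (fastforce simp: coeff_ring_def)
  qed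
  have "(of_int k :: coeff) = Poly_Mapping.single 0 (of_int k)"
    by (rule single_of_int[symmetric])
  then show "of_int k \<in> coeff_ring n"
    unfolding coeff_ring_def by (simp del: single_of_int)
  show "i \<in> {1..n} \<Longrightarrow> Rvar i \<in> coeff_ring n"
    by (simp add: coeff_ring_def Rvar_def)
qed

lemma coeff_ring_0: "0 \<in> coeff_ring n" and coeff_ring_1: "1 \<in> coeff_ring n"
  by (auto simp: coeff_ring_def)

lemma coeff_ring_Dlt: "i \<le> n \<Longrightarrow> Dlt i \<in> coeff_ring n"
proof (induction i)
  case (Suc i)
  then show ?case using coeff_ring_Rvar[of "Suc i" n] by (simp add: Dlt_def coeff_ring_mult)
qed (simp add: Dlt_def coeff_ring_1)

lemma expos_add: "d \<in> expos j \<Longrightarrow> e \<in> expos j \<Longrightarrow> d + e \<in> expos j"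
  using keys_add[of "fst d" "fst e"] keys_add[of "snd d" "snd e"] by (fastforce simp: expos_def)

lemma expos_uminus: "e \<in> expos j \<Longrightarrow> - e \<in> expos j"
  by (auto simp: expos_def)

lemma expos_0: "0 \<in> expos j"
  by (auto simp: expos_def zero_prod_def)

lemma expos_single: "i \<in> {1..j} \<Longrightarrow> (Poly_Mapping.single i a, Poly_Mapping.single i b) \<in> expos j"
  by (auto simp: expos_def)

lemma expos_lookup:
  "e \<in> expos j \<Longrightarrow> i \<notin> {1..j} \<Longrightarrow> Poly_Mapping.lookup (fst e) i = 0 \<and> Poly_Mapping.lookup (snd e) i = 0"
  by (auto simp: expos_def in_keys_iff)

lemma expos_Suc:
  "e \<in> expos j \<longleftrightarrow> e \<in> expos (Suc j) \<and> Poly_Mapping.lookup (fst e) (Suc j) = 0 \<and>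
     Poly_Mapping.lookup (snd e) (Suc j) = 0"
  by (auto simp: expos_def in_keys_iff subset_iff le_Suc_eq)

lemma expos_mono: "i \<le> j \<Longrightarrow> expos i \<subseteq> expos j"
  by (fastforce simp: expos_def)

lemma laurent_lookup: "p \<in> laurent n j \<Longrightarrow> Poly_Mapping.lookup p e \<in> coeff_ring n"
  by (cases "e \<in> Poly_Mapping.keys p") (auto simp: laurent_def in_keys_iff coeff_ring_0)

lemma laurent_0: "0 \<in> laurent n j"
  by (simp add: laurent_def)

lemma laurent_add: "p \<in> laurent n j \<Longrightarrow> q \<in> laurent n j \<Longrightarrow> p + q \<in> laurent n j"
  using keys_add[of p q] laurent_lookup[of p n j] laurent_lookup[of q n j]
  by (fastforce simp: laurent_def lookup_add intro: coeff_ring_add)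

lemma laurent_sum: "(\<And>i. i \<in> S \<Longrightarrow> f i \<in> laurent n j) \<Longrightarrow> sum f S \<in> laurent n j"
  by (induction S rule: infinite_finite_induct) (auto intro: laurent_0 laurent_add)

lemma laurent_single: "e \<in> expos j \<Longrightarrow> c \<in> coeff_ring n \<Longrightarrow> Poly_Mapping.single e c \<in> laurent n j"
  by (auto simp: laurent_def)

lemma laurent_mult:
  assumes "p \<in> laurent n j" "q \<in> laurent n j"
  shows "p * q \<in> laurent n j"
proof -
  have "p * q = (\<Sum>d\<in>Poly_Mapping.keys p. \<Sum>e\<in>Poly_Mapping.keys q.
      Poly_Mapping.single (d + e) (Poly_Mapping.lookup p d * Poly_Mapping.lookup q e))"
    by (subst sum_single_keys[of p, symmetric], subst sum_single_keys[of q, symmetric])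
      (simp only: sum_product mult_single)
  moreover have "\<dots> \<in> laurent n j"
    using assms by (intro laurent_sum laurent_single expos_add coeff_ring_mult)
      (auto simp: laurent_def)
  ultimately show ?thesis by simp
qed

lemma laurent_const: "c \<in> coeff_ring n \<Longrightarrow> const c \<in> laurent n j"
  by (simp add: const_def laurent_single expos_0)

lemma laurent_monom: "e \<in> expos j \<Longrightarrow> monom_xy e \<in> laurent n j"
  by (simp add: monom_xy_def laurent_single coeff_ring_1)

lemma laurent_1: "1 \<in> laurent n j"
  using laurent_const[OF coeff_ring_1] by (simp add: const_def)

lemma laurent_of_int: "of_int k \<in> laurent n j"
  using laurent_const[OF coeff_ring_of_int[of k]] by (simp add: const_def)

lemma laurent_prod: "(\<And>i. i \<in> S \<Longrightarrow> f i \<in> laurent n j) \<Longrightarrow> prod f S \<in> laurent n j"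
  by (induction S rule: infinite_finite_induct) (auto intro: laurent_1 laurent_mult)

lemma laurent_xpow: "i \<in> {1..j} \<Longrightarrow> xpow i m \<in> laurent n j"
  using expos_single[of i j m 0] by (simp add: xpow_def laurent_monom)

lemma laurent_ypow: "i \<in> {1..j} \<Longrightarrow> ypow i m \<in> laurent n j"
  using expos_single[of i j 0 m] by (simp add: ypow_def laurent_monom)

lemma laurent_dvar: "i \<in> {1..j} \<Longrightarrow> j \<le> n \<Longrightarrow> dvar i \<in> laurent n j"
  unfolding dvar_def
  by (intro laurent_mult laurent_prod laurent_const laurent_xpow laurent_ypow coeff_ring_Dlt) auto

lemma laurent_ddx: "p \<in> laurent n j \<Longrightarrow> i \<in> {1..j} \<Longrightarrow> ddx i p \<in> laurent n j"
  unfolding ddx_def using expos_single[of i j "-1" 0]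
  by (intro laurent_sum laurent_single expos_add coeff_ring_mult coeff_ring_of_int)
    (auto simp: laurent_def)

lemma laurent_ddy: "p \<in> laurent n j \<Longrightarrow> i \<in> {1..j} \<Longrightarrow> ddy i p \<in> laurent n j"
  unfolding ddy_def using expos_single[of i j 0 "-1"]
  by (intro laurent_sum laurent_single expos_add coeff_ring_mult coeff_ring_of_int)
    (auto simp: laurent_def)

lemma ddx_eq_0: "p \<in> laurent n j \<Longrightarrow> i \<notin> {1..j} \<Longrightarrow> ddx i p = 0"
  unfolding ddx_def using expos_lookup by (intro sum.neutral) (force simp: laurent_def)

lemma ddy_eq_0: "p \<in> laurent n j \<Longrightarrow> i \<notin> {1..j} \<Longrightarrow> ddy i p = 0"
  unfolding ddy_def using expos_lookup by (intro sum.neutral) (force simp: laurent_def)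

text \<open>Variables with index above \<open>j\<close> contribute nothing to the sum, and
  \<open>dvar i\<close> involves only variables up to index \<open>i\<close>.\<close>

lemma laurent_dd_deriv: "p \<in> laurent n j \<Longrightarrow> j \<le> n \<Longrightarrow> dd_deriv n p \<in> laurent n j"
  unfolding dd_deriv_def
proof (intro laurent_sum)
  fix i assume "p \<in> laurent n j" "j \<le> n"
  then show "(ddx i p + ddy i p) * dvar i \<in> laurent n j"
    by (cases "i \<in> {1..j}")
      (auto simp: ddx_eq_0 ddy_eq_0 laurent_0 laurent_ddx laurent_ddy laurent_dvar
        intro!: laurent_mult laurent_add)
qed

lemma dd_deriv_laurent_0: "p \<in> laurent n 0 \<Longrightarrow> dd_deriv n p = 0"
  by (simp add: dd_deriv_def ddx_eq_0 ddy_eq_0)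

lemma dd_deriv_0 [simp]: "dd_deriv n 0 = 0"
  by (simp add: dd_deriv_laurent_0 laurent_0)

lemma dd_deriv_sum: "dd_deriv n (sum f S) = (\<Sum>i\<in>S. dd_deriv n (f i))"
  by (induction S rule: infinite_finite_induct) (auto simp: dd_deriv_add)

section \<open>Extracting coefficients from products with monomials and from derivatives\<close>

lemma laurent_xy_coeff:
  assumes "p \<in> laurent n (Suc j)"
  shows "xy_coeff (Suc j) a b p \<in> laurent n j"
  unfolding laurent_def
proof safe
  fix e1 e2 assume "(e1, e2) \<in> Poly_Mapping.keys (xy_coeff (Suc j) a b p)"
  then have 0: "Poly_Mapping.lookup e1 (Suc j) = 0" "Poly_Mapping.lookup e2 (Suc j) = 0"
    and "(e1, e2) + (Poly_Mapping.single (Suc j) a, Poly_Mapping.single (Suc j) b) \<in> Poly_Mapping.keys p"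
    by (auto simp: in_keys_iff lookup_xy_coeff split: if_splits)
  then have "(e1, e2) + (Poly_Mapping.single (Suc j) a, Poly_Mapping.single (Suc j) b) +
      - (Poly_Mapping.single (Suc j) a, Poly_Mapping.single (Suc j) b) \<in> expos (Suc j)"
    using assms unfolding laurent_def by (intro expos_add[OF _ expos_uminus] expos_single) auto
  then show "(e1, e2) \<in> expos j" using 0 by (subst expos_Suc) simp
  show "Poly_Mapping.lookup (xy_coeff (Suc j) a b p) (e1, e2) \<in> coeff_ring n"
    using laurent_lookup[OF assms] by (simp add: lookup_xy_coeff coeff_ring_0)
qed

text \<open>The part of the exponent at index \<open>Suc j\<close> shifts the extracted powers; the
  lower part \<open>d\<close> only multiplies the coefficient. Division by the regularization
  monomial has this form.\<close>

lemma xy_coeff_mult_monom: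
  assumes "d \<in> expos j"
  shows "xy_coeff (Suc j) a b (p * monom_xy ((Poly_Mapping.single (Suc j) u, Poly_Mapping.single (Suc j) v) + d)) =
    xy_coeff (Suc j) (a - u) (b - v) p * monom_xy d"
proof (rule poly_mapping_eqI)
  fix e :: expo
  have eq: "e + (Poly_Mapping.single (Suc j) a, Poly_Mapping.single (Suc j) b) -
      ((Poly_Mapping.single (Suc j) u, Poly_Mapping.single (Suc j) v) + d) =
      e - d + (Poly_Mapping.single (Suc j) (a - u), Poly_Mapping.single (Suc j) (b - v))"
    by (simp add: prod_eq_iff single_diff)
  show "Poly_Mapping.lookup (xy_coeff (Suc j) a b (p *
      monom_xy ((Poly_Mapping.single (Suc j) u, Poly_Mapping.single (Suc j) v) + d))) e =
    Poly_Mapping.lookup (xy_coeff (Suc j) (a - u) (b - v) p * monom_xy d) e"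
    using expos_lookup[OF assms, of "Suc j"]
    unfolding lookup_xy_coeff lookup_mult_monom eq by (simp add: lookup_minus)
qed

lemma xy_coeff_mult_powers:
  assumes "q \<in> laurent n j"
  shows "xy_coeff (Suc j) a b (q * monom_xy (Poly_Mapping.single (Suc j) u, Poly_Mapping.single (Suc j) v)) =
    (if a = u \<and> b = v then q else 0)"
proof (rule poly_mapping_eqI)
  fix e :: expo
  let ?e = "e + (Poly_Mapping.single (Suc j) a, Poly_Mapping.single (Suc j) b) -
      (Poly_Mapping.single (Suc j) u, Poly_Mapping.single (Suc j) v)"
  have 0: "Poly_Mapping.lookup q d = 0"
    if "Poly_Mapping.lookup (fst d) (Suc j) \<noteq> 0 \<or> Poly_Mapping.lookup (snd d) (Suc j) \<noteq> 0" for d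
  proof -
    have "d \<notin> expos j" using that expos_lookup[of d j "Suc j"] by auto
    then have "d \<notin> Poly_Mapping.keys q" using assms by (auto simp: laurent_def)
    then show ?thesis by (simp add: in_keys_iff)
  qed
  have "Poly_Mapping.lookup q ?e = 0"
    if "Poly_Mapping.lookup (fst e) (Suc j) = 0" "Poly_Mapping.lookup (snd e) (Suc j) = 0" "a \<noteq> u \<or> b \<noteq> v"
    using that by (intro 0) (auto simp: lookup_add lookup_minus)
  then show "Poly_Mapping.lookup (xy_coeff (Suc j) a b (q *
      monom_xy (Poly_Mapping.single (Suc j) u, Poly_Mapping.single (Suc j) v))) e =
    Poly_Mapping.lookup (if a = u \<and> b = v then q else 0) e"
    using 0[of e] by (auto simp: lookup_xy_coeff lookup_mult_monom)
qed

text \<open>The factor of \<open>dvar j\<close> free of \<open>x\<^sub>j\<close>: the derivation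
  sends \<open>x\<^sub>j\<close> and \<open>y\<^sub>j\<close> to \<open>dcoeff j\<close> times
  \<open>x\<^sub>j\<close>.\<close>

definition dcoeff :: "nat \<Rightarrow> laur" where
  "dcoeff j = const (Dlt j) * (\<Prod>i=1..<j. xpow i 1 * ypow i (-1))"

lemma laurent_dcoeff: "Suc j \<le> n \<Longrightarrow> dcoeff (Suc j) \<in> laurent n j"
  unfolding dcoeff_def
  by (intro laurent_mult laurent_prod laurent_const laurent_xpow laurent_ypow coeff_ring_Dlt) auto

lemma single_of_int_mult: "Poly_Mapping.single e (of_int k) = of_int k * monom_xy e" for e :: expo
proof -
  have "of_int k * monom_xy e = Poly_Mapping.single 0 (of_int k) * monom_xy e" by simp
  then show ?thesis by (simp add: monom_xy_def mult_single del: single_of_int)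
qed

text \<open>Differentiating a factor \<open>x\<^sub>j\<close> keeps the powers, while
  differentiating a factor \<open>y\<^sub>j\<close> trades it for \<open>x\<^sub>j\<close>.\<close>

lemma dd_deriv_powers:
  assumes "j \<in> {1..n}"
  shows "dd_deriv n (monom_xy (Poly_Mapping.single j u, Poly_Mapping.single j v)) =
    dcoeff j * (of_int u * monom_xy (Poly_Mapping.single j u, Poly_Mapping.single j v)
      + of_int v * monom_xy (Poly_Mapping.single j (u + 1), Poly_Mapping.single j (v - 1)))"
proof -
  let ?m = "monom_xy (Poly_Mapping.single j u, Poly_Mapping.single j v)"
  have "(ddx i ?m + ddy i ?m) * dvar i = (if i = j then (ddx j ?m + ddy j ?m) * dvar j else 0)" for i
    by (cases "i = j") (simp_all add: monom_xy_def ddx_single ddy_single lookup_single_not_eq)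
  then have "dd_deriv n ?m = (\<Sum>i=1..n. if i = j then (ddx j ?m + ddy j ?m) * dvar j else 0)"
    unfolding dd_deriv_def by (rule sum.cong[OF refl])
  also have "\<dots> = (ddx j ?m + ddy j ?m) * dvar j"
    using assms by simp
  also have "ddx j ?m = of_int u * monom_xy (Poly_Mapping.single j (u - 1), Poly_Mapping.single j v)"
    unfolding single_of_int_mult[symmetric] by (simp add: monom_xy_def ddx_single single_add[symmetric])
  also have "ddy j ?m = of_int v * monom_xy (Poly_Mapping.single j u, Poly_Mapping.single j (v - 1))"
    unfolding single_of_int_mult[symmetric] by (simp add: monom_xy_def ddy_single single_add[symmetric])
  also have "dvar j = dcoeff j * monom_xy (Poly_Mapping.single j 1, 0)"
    by (simp add: dvar_def dcoeff_def xpow_def ac_simps)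
  also have "(of_int u * monom_xy (Poly_Mapping.single j (u - 1), Poly_Mapping.single j v) +
      of_int v * monom_xy (Poly_Mapping.single j u, Poly_Mapping.single j (v - 1))) *
      (dcoeff j * monom_xy (Poly_Mapping.single j 1, 0)) = dcoeff j *
      (of_int u * (monom_xy (Poly_Mapping.single j (u - 1), Poly_Mapping.single j v) * monom_xy (Poly_Mapping.single j 1, 0)) +
      of_int v * (monom_xy (Poly_Mapping.single j u, Poly_Mapping.single j (v - 1)) * monom_xy (Poly_Mapping.single j 1, 0)))"
    by (simp add: algebra_simps)
  finally show ?thesis
    by (simp add: monom_xy_mult[symmetric] single_add[symmetric])
qed

text \<open>By \<open>dd_deriv_powers\<close> only the powers \<open>(a, b)\<close> and
  \<open>(a - 1, b + 1)\<close> feed the power \<open>(a, b)\<close>. For \<open>a = 0\<close> and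
  in the absence of negative powers the correction vanishes, so the coefficient of a pure power of
  \<open>y\<close> evolves by the derivation alone; termination rests on this.\<close>

lemma xy_coeff_dd_deriv:
  assumes "p \<in> laurent n (Suc j)" "Suc j \<le> n"
  shows "xy_coeff (Suc j) a b (dd_deriv n p) = dd_deriv n (xy_coeff (Suc j) a b p) +
    dcoeff (Suc j) * (of_int a * xy_coeff (Suc j) a b p +
      of_int (b + 1) * xy_coeff (Suc j) (a - 1) (b + 1) p)"
proof -
  let ?P = "\<lambda>p. xy_coeff (Suc j) a b (dd_deriv n p) = dd_deriv n (xy_coeff (Suc j) a b p) +
    dcoeff (Suc j) * (of_int a * xy_coeff (Suc j) a b p +
      of_int (b + 1) * xy_coeff (Suc j) (a - 1) (b + 1) p)"
  have "?P (Poly_Mapping.single e c)" if e: "e \<in> expos (Suc j)" and c: "c \<in> coeff_ring n" for e c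
  proof -
    define u v where "u = Poly_Mapping.lookup (fst e) (Suc j)" and "v = Poly_Mapping.lookup (snd e) (Suc j)"
    let ?m = "\<lambda>u v. monom_xy (Poly_Mapping.single (Suc j) u, Poly_Mapping.single (Suc j) v)"
    \<comment> \<open>Removing the powers of index \<open>Suc j\<close> leaves a term
      \<open>q\<close> in the lower variables.\<close>
    define d where "d = e + - (Poly_Mapping.single (Suc j) u, Poly_Mapping.single (Suc j) v)"
    define q where "q = Poly_Mapping.single d c"
    have "d \<in> expos (Suc j)" unfolding d_def using e
      by (intro expos_add expos_uminus expos_single) auto
    then have "d \<in> expos j"
      by (subst expos_Suc) (simp add: d_def u_def v_def lookup_add lookup_minus)
    then have q: "q \<in> laurent n j" using c by (simp add: q_def laurent_single)
    have eq: "Poly_Mapping.single e c = q * ?m u v"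
    proof -
      have "d + (Poly_Mapping.single (Suc j) u, Poly_Mapping.single (Suc j) v) = e"
        by (simp add: d_def prod_eq_iff)
      then show ?thesis by (simp add: q_def monom_xy_def mult_single)
    qed
    have qd: "q * (dcoeff (Suc j) * of_int k) \<in> laurent n j" for k
      using assms q by (intro laurent_mult laurent_dcoeff laurent_of_int)
    have "dd_deriv n (q * ?m u v) = dd_deriv n q * ?m u v + (q * (dcoeff (Suc j) * of_int u)) * ?m u v +
        (q * (dcoeff (Suc j) * of_int v)) * ?m (u + 1) (v - 1)"
      using assms(2) by (simp add: dd_deriv_mult dd_deriv_powers algebra_simps)
    then have "xy_coeff (Suc j) a b (dd_deriv n (q * ?m u v)) =
        (if a = u \<and> b = v then dd_deriv n q else 0) +
        (if a = u \<and> b = v then q * (dcoeff (Suc j) * of_int u) else 0) +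
        (if a = u + 1 \<and> b = v - 1 then q * (dcoeff (Suc j) * of_int v) else 0)"
      using assms(2) by (simp only: xy_coeff_add xy_coeff_mult_powers[OF qd]
          xy_coeff_mult_powers[OF laurent_dd_deriv[OF q]] Suc_leD)
    then show ?thesis unfolding eq xy_coeff_mult_powers[OF q]
      by (auto simp: algebra_simps)
  qed
  then have "?P (\<Sum>e\<in>Poly_Mapping.keys p. Poly_Mapping.single e (Poly_Mapping.lookup p e))"
    using assms(1) unfolding dd_deriv_sum xy_coeff_sum
    by (simp add: laurent_def sum.distrib sum_distrib_left ring_distribs)
  then show ?thesis unfolding sum_single_keys .
qed

definition hom_deg :: "(nat \<Rightarrow>\<^sub>0 int) \<Rightarrow> laur \<Rightarrow> bool" where
  "hom_deg d p \<longleftrightarrow> (\<forall>e \<in> Poly_Mapping.keys p. fst e + snd e = d)"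

lemma hom_deg_homogeneous: "hom_deg d p \<Longrightarrow> p \<noteq> 0 \<Longrightarrow> homogeneous p"
  by (auto simp: hom_deg_def homogeneous_def)

lemma hom_deg_pdeg: "hom_deg d p \<Longrightarrow> p \<noteq> 0 \<Longrightarrow> pdeg p = d"
  using homogeneous_pdeg[OF hom_deg_homogeneous] by (metis hom_deg_def keys_eq_empty all_not_in_conv)

lemma hom_deg_0: "hom_deg d 0"
  by (simp add: hom_deg_def)

lemma hom_deg_add: "hom_deg d p \<Longrightarrow> hom_deg d q \<Longrightarrow> hom_deg d (p + q)"
  using keys_add[of p q] by (auto simp: hom_deg_def)

lemma hom_deg_sum: "(\<And>i. i \<in> S \<Longrightarrow> hom_deg d (f i)) \<Longrightarrow> hom_deg d (sum f S)"
  by (induction S rule: infinite_finite_induct) (auto intro: hom_deg_0 hom_deg_add)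

lemma hom_deg_single: "d = fst e + snd e \<Longrightarrow> hom_deg d (Poly_Mapping.single e c)"
  by (simp add: hom_deg_def)

lemma hom_deg_mult:
  assumes "hom_deg d p" "hom_deg d' q"
  shows "hom_deg (d + d') (p * q)"
  unfolding hom_deg_def
proof
  fix e assume "e \<in> Poly_Mapping.keys (p * q)"
  then obtain u v where "u \<in> Poly_Mapping.keys p" "v \<in> Poly_Mapping.keys q" "e = u + v"
    using keys_mult[of p q] by blast
  then show "fst e + snd e = d + d'" using assms by (force simp: hom_deg_def ac_simps)
qed

lemma hom_deg_const: "hom_deg 0 (const c)"
  by (simp add: const_def hom_deg_single)

lemma hom_deg_xpow: "hom_deg (Poly_Mapping.single i m) (xpow i m)"
  and hom_deg_ypow: "hom_deg (Poly_Mapping.single i m) (ypow i m)"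
  by (simp_all add: xpow_def ypow_def monom_xy_def hom_deg_single)

lemma hom_deg_prod: "(\<And>i. i \<in> S \<Longrightarrow> hom_deg (d i) (f i)) \<Longrightarrow> hom_deg (sum d S) (prod f S)"
proof (induction S rule: infinite_finite_induct)
  case (insert i S)
  then show ?case by (simp add: hom_deg_mult)
qed (use hom_deg_const[of 1] in \<open>auto simp: const_def\<close>)

lemma hom_deg_dvar: "hom_deg (Poly_Mapping.single j 1) (dvar j)"
proof -
  have "hom_deg (0 + Poly_Mapping.single j 1 + (\<Sum>i=1..<j. Poly_Mapping.single i 1 + Poly_Mapping.single i (-1))) (dvar j)"
    unfolding dvar_def by (intro hom_deg_mult hom_deg_prod hom_deg_const hom_deg_xpow hom_deg_ypow)
  moreover have "(Poly_Mapping.single i 1 :: nat \<Rightarrow>\<^sub>0 int) + Poly_Mapping.single i (-1) = 0" for i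
    by (simp add: single_add[symmetric])
  ultimately show ?thesis by simp
qed

text \<open>\<open>ddx j\<close> and \<open>ddy j\<close> lower the degree at \<open>j\<close> by
  one, and \<open>dvar j\<close> restores it.\<close>

lemma hom_deg_dd_deriv:
  assumes "hom_deg d p"
  shows "hom_deg d (dd_deriv n p)"
proof -
  have x: "hom_deg (d + Poly_Mapping.single j (-1)) (ddx j p)"
    and y: "hom_deg (d + Poly_Mapping.single j (-1)) (ddy j p)" for j
    using assms unfolding ddx_def ddy_def
    by (intro hom_deg_sum hom_deg_single, force simp: hom_deg_def add_ac)+
  have "hom_deg (d + Poly_Mapping.single j (-1) + Poly_Mapping.single j 1) ((ddx j p + ddy j p) * dvar j)" for j
    by (intro hom_deg_mult hom_deg_add x y hom_deg_dvar)
  moreover have "d + Poly_Mapping.single j (-1) + Poly_Mapping.single j 1 = d" for j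
    by (simp add: add.assoc single_add[symmetric])
  ultimately show ?thesis unfolding dd_deriv_def by (intro hom_deg_sum) simp
qed

lemma hom_deg_xy_coeff:
  assumes "hom_deg d p"
  shows "hom_deg (d - Poly_Mapping.single j (a + b)) (xy_coeff j a b p)"
  unfolding xy_coeff_def using assms
  by (intro hom_deg_sum hom_deg_single) (auto simp: hom_deg_def single_add algebra_simps)

lemma reg_expo_expos: "reg_expo j p \<in> expos j"
proof (induction j arbitrary: p)
  case (Suc j)
  then show ?case using expos_mono[of j "Suc j"]
    by (auto simp: Let_def intro!: expos_add expos_single simp del: plus_prod_def)
qed (simp add: expos_0)

section \<open>Termination of the derivation-division sequence\<close>

text \<open>The level \<open>j\<close> of the division is separate from \<open>n\<close>: in the
  induction on the number of variables, coefficients follow sequences of lower level under the same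
  derivation.\<close>

definition dd_step :: "nat \<Rightarrow> nat \<Rightarrow> laur \<Rightarrow> laur" where
  "dd_step n j p = (let p' = dd_deriv n p in if p' = 0 then 0 else div_reg j p')"

lemma dd_seq_eq_funpow: "dd_seq n p k = (dd_step n n ^^ k) p"
  by (induction k) (simp_all add: dd_step_def)

lemma xy_coeff_nonzero_key:
  assumes "xy_coeff j a b p \<noteq> 0"
  obtains e where "e \<in> Poly_Mapping.keys p"
    "Poly_Mapping.lookup (fst e) j = a" "Poly_Mapping.lookup (snd e) j = b"
proof -
  have "{e \<in> Poly_Mapping.keys p. Poly_Mapping.lookup (fst e) j = a \<and> Poly_Mapping.lookup (snd e) j = b} \<noteq> {}"
    using assms by (auto simp only: xy_coeff_def sum.empty)
  then show thesis using that by blast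
qed

definition nonneg_expo :: "nat \<Rightarrow> laur \<Rightarrow> bool" where
  "nonneg_expo j p \<longleftrightarrow> (\<forall>e \<in> Poly_Mapping.keys p.
     0 \<le> Poly_Mapping.lookup (fst e) j \<and> 0 \<le> Poly_Mapping.lookup (snd e) j)"

lemma nonneg_expo_xy_coeff: "nonneg_expo j p \<Longrightarrow> a < 0 \<or> b < 0 \<Longrightarrow> xy_coeff j a b p = 0"
  by (metis nonneg_expo_def xy_coeff_nonzero_key linorder_not_less)

text \<open>At index \<open>Suc j\<close> the derivation lowers only the exponent of
  \<open>y\<close>, and a drop from \<open>0\<close> to \<open>-1\<close> carries the factor
  zero.\<close>

lemma nonneg_expo_dd_deriv:
  assumes "p \<in> laurent n (Suc j)" "Suc j \<le> n" "nonneg_expo (Suc j) p"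
  shows "nonneg_expo (Suc j) (dd_deriv n p)"
  unfolding nonneg_expo_def
proof
  fix e assume e: "e \<in> Poly_Mapping.keys (dd_deriv n p)"
  let ?a = "Poly_Mapping.lookup (fst e) (Suc j)" and ?b = "Poly_Mapping.lookup (snd e) (Suc j)"
  have nz: "xy_coeff (Suc j) ?a ?b (dd_deriv n p) \<noteq> 0"
    using xy_coeff_eq_0[OF _ e] by blast
  have "xy_coeff (Suc j) ?a ?b (dd_deriv n p) = 0" if neg: "?a < 0 \<or> ?b < 0"
  proof -
    have 0: "xy_coeff (Suc j) ?a ?b p = 0"
      using nonneg_expo_xy_coeff[OF assms(3) neg] .
    have "of_int (?b + 1) * xy_coeff (Suc j) (?a - 1) (?b + 1) p = 0"
    proof (cases "?b = - 1")
      case False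
      then have "xy_coeff (Suc j) (?a - 1) (?b + 1) p = 0"
        using neg by (intro nonneg_expo_xy_coeff[OF assms(3)]) auto
      then show ?thesis by simp
    qed simp
    then show ?thesis
      unfolding xy_coeff_dd_deriv[OF assms(1,2)] 0 by simp
  qed
  then show "0 \<le> ?a \<and> 0 \<le> ?b" using nz by force
qed

text \<open>At index \<open>Suc j\<close> the term with power \<open>i\<close> of \<open>x\<close>
  receives the powers \<open>i - n0\<close> of \<open>x\<close> and \<open>n1 - i\<close> of
  \<open>y\<close>. So no negative power remains and the degree is \<open>n1 - n0\<close>. The pure
  power of \<open>y\<close> comes from \<open>i = n0\<close>, the coefficient on which
  \<open>reg_expo\<close> recurses, which is thus divided by its own regularization
  monomial.\<close>

lemma div_reg_expansion:
  assumes p: "p \<in> laurent n (Suc j)" "p \<noteq> 0" and hom: "hom_deg d p"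
  defines "m \<equiv> Poly_Mapping.lookup d (Suc j)"
  obtains n0 n1 d' where "xy_coeff (Suc j) n0 (m - n0) p \<noteq> 0" "xy_coeff (Suc j) n1 (m - n1) p \<noteq> 0"
    "xy_coeff (Suc j) 0 (n1 - n0) (div_reg (Suc j) p) = div_reg j (xy_coeff (Suc j) n0 (m - n0) p)"
    "hom_deg d' (div_reg (Suc j) p)" "Poly_Mapping.lookup d' (Suc j) = n1 - n0" "n0 \<le> n1"
    "div_reg (Suc j) p \<in> laurent n (Suc j)" "nonneg_expo (Suc j) (div_reg (Suc j) p)"
proof -
  define N where "N = {i. xy_coeff (Suc j) i (m - i) p \<noteq> 0}"
  have pd: "pdeg p = d" by (rule hom_deg_pdeg[OF hom p(2)])
  have N: "finite N" "N \<noteq> {}"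
    using homogeneous_expansion(1,2)[OF hom_deg_homogeneous[OF hom p(2)], of "Suc j"]
    unfolding N_def m_def pd by auto
  define n0 n1 where "n0 = Min N" and "n1 = Max N"
  have nN: "n0 \<in> N" "n1 \<in> N" using N by (simp_all add: n0_def n1_def)
  define q where "q = xy_coeff (Suc j) n0 (m - n0) p"
  let ?r = "- reg_expo j q"
  let ?s = "(Poly_Mapping.single (Suc j) (- n0), Poly_Mapping.single (Suc j) (n1 - m)) :: expo"
  have "reg_expo (Suc j) p = (Poly_Mapping.single (Suc j) n0, Poly_Mapping.single (Suc j) (m - n1)) + reg_expo j q"
    by (simp add: Let_def pd m_def[symmetric] N_def[symmetric] n0_def[symmetric] n1_def[symmetric] q_def)
  then have "- reg_expo (Suc j) p = ?s + ?r"
    by (simp add: prod_eq_iff single_diff single_uminus)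
  then have eq: "div_reg (Suc j) p = p * monom_xy (?s + ?r)"
    by (simp only: div_reg_def)
  have r: "?r \<in> expos j" by (intro expos_uminus reg_expo_expos)
  have r0: "Poly_Mapping.lookup (fst ?r) (Suc j) = 0" "Poly_Mapping.lookup (snd ?r) (Suc j) = 0"
    using expos_lookup[OF r, of "Suc j"] by auto
  show thesis
  proof (rule that[of n0 n1 "d + (fst (?s + ?r) + snd (?s + ?r))"])
    show "xy_coeff (Suc j) n0 (m - n0) p \<noteq> 0" "xy_coeff (Suc j) n1 (m - n1) p \<noteq> 0"
      using nN by (simp_all add: N_def)
    show "n0 \<le> n1" using N nN by (simp add: n0_def)
    show "xy_coeff (Suc j) 0 (n1 - n0) (div_reg (Suc j) p) = div_reg j (xy_coeff (Suc j) n0 (m - n0) p)"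
      unfolding eq xy_coeff_mult_monom[OF r] by (simp add: div_reg_def q_def)
    show "hom_deg (d + (fst (?s + ?r) + snd (?s + ?r))) (div_reg (Suc j) p)"
      unfolding eq by (intro hom_deg_mult hom) (simp add: monom_xy_def hom_deg_single)
    show "Poly_Mapping.lookup (d + (fst (?s + ?r) + snd (?s + ?r))) (Suc j) = n1 - n0"
      using r0 by (simp add: lookup_add lookup_minus m_def)
    show "div_reg (Suc j) p \<in> laurent n (Suc j)"
      unfolding div_reg_def using p(1)
      by (intro laurent_mult laurent_monom expos_uminus reg_expo_expos)
    show "nonneg_expo (Suc j) (div_reg (Suc j) p)"
      unfolding nonneg_expo_def
    proof
      fix e assume "e \<in> Poly_Mapping.keys (div_reg (Suc j) p)"
      then have k: "e - (?s + ?r) \<in> Poly_Mapping.keys p" unfolding eq keys_mult_monom .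
      let ?a = "Poly_Mapping.lookup (fst (e - (?s + ?r))) (Suc j)"
      have a: "?a = Poly_Mapping.lookup (fst e) (Suc j) + n0"
        using r0 by (simp add: lookup_add lookup_minus)
      have b: "Poly_Mapping.lookup (snd (e - (?s + ?r))) (Suc j) =
          Poly_Mapping.lookup (snd e) (Suc j) - (n1 - m)"
        using r0 by (simp add: lookup_add lookup_minus)
      have "m = ?a + Poly_Mapping.lookup (snd (e - (?s + ?r))) (Suc j)"
        using hom k by (auto simp only: hom_deg_def m_def lookup_add[symmetric])
      then have ab: "Poly_Mapping.lookup (snd (e - (?s + ?r))) (Suc j) = m - ?a" by simp
      then have "?a \<in> N" using xy_coeff_eq_0[OF _ k, of "Suc j" ?a "m - ?a"] unfolding N_def by blast
      then have "n0 \<le> ?a" "?a \<le> n1" using N by (simp_all add: n0_def n1_def)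
      then show "0 \<le> Poly_Mapping.lookup (fst e) (Suc j) \<and> 0 \<le> Poly_Mapping.lookup (snd e) (Suc j)"
        using a b ab by auto
    qed
  qed
qed

text \<open>The coefficient of \<open>y\<^sub>j\<^sup>m\<close> runs through its own derivation-division sequence until the
  degree \<open>m\<close> in \<open>x\<^sub>j, y\<^sub>j\<close> drops; this must happen at the latest when that coefficient is constant.\<close>

lemma dd_terminates_nonneg:
  assumes IH: "\<And>p d. p \<in> laurent n j \<Longrightarrow> hom_deg d p \<Longrightarrow> \<exists>k. (dd_step n j ^^ k) p \<in> laurent n 0"
    and j: "Suc j \<le> n"
  shows "p \<in> laurent n (Suc j) \<Longrightarrow> hom_deg d p \<Longrightarrow> nonneg_expo (Suc j) p \<Longrightarrow>
    Poly_Mapping.lookup d (Suc j) = int m \<Longrightarrow>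
    (dd_step n j ^^ K) (xy_coeff (Suc j) 0 (int m) p) \<in> laurent n 0 \<Longrightarrow>
    \<exists>k. (dd_step n (Suc j) ^^ k) p \<in> laurent n 0"
proof (induction m arbitrary: p d K rule: less_induct)
  case (less m)
  \<comment> \<open>The outer induction is on the degree \<open>m\<close>, the inner one on the
    number \<open>K\<close> of steps after which the coefficient of the pure power of
    \<open>y\<close> is constant.\<close>
  note IH_m = less.IH
  from less.prems show ?case
  proof (induction K arbitrary: p d rule: less_induct)
    case (less K)
    let ?p' = "dd_deriv n p"
    let ?q = "xy_coeff (Suc j) 0 (int m) p"
    show ?case
    proof (cases "?p' = 0")
      case True
      then have "(dd_step n (Suc j) ^^ 1) p \<in> laurent n 0"
        by (simp add: dd_step_def laurent_0)
      then show ?thesis by blast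
    next
      case False
      have p': "?p' \<in> laurent n (Suc j)" "hom_deg d ?p'" "nonneg_expo (Suc j) ?p'"
        using less.prems j by (simp_all add: laurent_dd_deriv hom_deg_dd_deriv nonneg_expo_dd_deriv)
      let ?p1 = "div_reg (Suc j) ?p'"
      have step: "dd_step n (Suc j) p = ?p1" using False by (simp add: dd_step_def)
      have suff: "\<exists>k. (dd_step n (Suc j) ^^ k) p \<in> laurent n 0"
        if "\<exists>k. (dd_step n (Suc j) ^^ k) ?p1 \<in> laurent n 0"
      proof -
        from that obtain k where "(dd_step n (Suc j) ^^ k) ?p1 \<in> laurent n 0" by blast
        then have "(dd_step n (Suc j) ^^ Suc k) p \<in> laurent n 0"
          by (simp only: funpow_Suc_right o_apply step)
        then show ?thesis by blast
      qed
      obtain n0 n1 d' where low: "xy_coeff (Suc j) n0 (int m - n0) ?p' \<noteq> 0"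
          and top: "xy_coeff (Suc j) n1 (int m - n1) ?p' \<noteq> 0"
          and coeff: "xy_coeff (Suc j) 0 (n1 - n0) ?p1 = div_reg j (xy_coeff (Suc j) n0 (int m - n0) ?p')"
          and p1: "hom_deg d' ?p1" "Poly_Mapping.lookup d' (Suc j) = n1 - n0"
            "?p1 \<in> laurent n (Suc j)" "nonneg_expo (Suc j) ?p1"
          and le: "n0 \<le> n1"
        using div_reg_expansion[OF p'(1) False p'(2)] unfolding less.prems(4) .
      \<comment> \<open>Nonnegative exponents with sum \<open>m\<close> confine the powers of
        \<open>x\<close> to the range from \<open>0\<close> to \<open>m\<close>, so the new degree
        \<open>m'\<close> is at most \<open>m\<close>.\<close>
      have n01: "0 \<le> n0" "n1 \<le> int m"
        using nonneg_expo_xy_coeff[OF p'(3)] low top by force+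
      define m' where "m' = nat (n1 - n0)"
      have m': "int m' = n1 - n0" using le by (simp add: m'_def)
      show ?thesis
      proof (cases "m' < m")
        case True
        \<comment> \<open>The new coefficient starts a sequence whose length \<open>K'\<close> is
          unrelated to \<open>K\<close>; the drop of the degree pays for it.\<close>
        obtain K' where "(dd_step n j ^^ K') (xy_coeff (Suc j) 0 (int m') ?p1) \<in> laurent n 0"
          using IH[OF laurent_xy_coeff[OF p1(3)] hom_deg_xy_coeff[OF p1(1)]] by blast
        then show ?thesis
          using IH_m[OF True p1(3,1,4)] p1(2) m' by (intro suff) auto
      next
        case False
        \<comment> \<open>Without a drop nothing is divided out at index \<open>Suc j\<close>, and
          the coefficient of the pure power advances by exactly one step of its own
          sequence.\<close>
        then have eqs: "n0 = 0" "n1 = int m" "m' = m" using n01 m' by auto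
        have "xy_coeff (Suc j) (- 1) (int m + 1) p = 0"
          using less.prems(3) by (intro nonneg_expo_xy_coeff) auto
        then have dq: "xy_coeff (Suc j) 0 (int m) ?p' = dd_deriv n ?q"
          using xy_coeff_dd_deriv[OF less.prems(1) j, of 0 "int m"] by simp
        then have "dd_deriv n ?q \<noteq> 0" using low eqs by simp
        then have step_q: "dd_step n j ?q = xy_coeff (Suc j) 0 (int m) ?p1"
          using coeff eqs dq by (simp add: dd_step_def)
        \<comment> \<open>A constant coefficient would have zero derivative; hence at least one of
          the \<open>K\<close> steps is still to come.\<close>
        have "?q \<notin> laurent n 0" using \<open>dd_deriv n ?q \<noteq> 0\<close> dd_deriv_laurent_0 by blast
        then have "K \<noteq> 0" using less.prems(5) by (cases K) auto
        then obtain K' where K': "K = Suc K'" by (cases K) auto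
        have "(dd_step n j ^^ K') (xy_coeff (Suc j) 0 (int m) ?p1) \<in> laurent n 0"
          using less.prems(5) unfolding K' funpow_Suc_right o_apply step_q .
        then show ?thesis
          using less.IH[of K' ?p1 d'] p1 eqs K' by (intro suff) auto
      qed
    qed
  qed
qed

text \<open>One preliminary step removes negative powers. Then \<open>dd_terminates_nonneg\<close>
  applies, and the previous level supplies the initial \<open>K\<close>.\<close>

lemma dd_terminates:
  "j \<le> n \<Longrightarrow> p \<in> laurent n j \<Longrightarrow> hom_deg d p \<Longrightarrow> \<exists>k. (dd_step n j ^^ k) p \<in> laurent n 0"
proof (induction j arbitrary: p d)
  case 0
  then have "(dd_step n 0 ^^ 0) p \<in> laurent n 0" by simp
  then show ?case by blast
next
  case (Suc j)
  have IH: "\<exists>k. (dd_step n j ^^ k) p \<in> laurent n 0" if "p \<in> laurent n j" "hom_deg d p" for p d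
    using Suc.IH[OF _ that] Suc.prems(1) by simp
  let ?p' = "dd_deriv n p"
  show ?case
  proof (cases "?p' = 0")
    case True
    then have "(dd_step n (Suc j) ^^ 1) p \<in> laurent n 0"
      by (simp add: dd_step_def laurent_0)
    then show ?thesis by blast
  next
    case False
    let ?p1 = "div_reg (Suc j) ?p'"
    have p': "?p' \<in> laurent n (Suc j)" "hom_deg d ?p'"
      using Suc.prems by (simp_all add: laurent_dd_deriv hom_deg_dd_deriv)
    obtain n0 n1 d' where p1: "?p1 \<in> laurent n (Suc j)" "hom_deg d' ?p1" "nonneg_expo (Suc j) ?p1"
        "Poly_Mapping.lookup d' (Suc j) = n1 - n0" and le: "n0 \<le> n1"
      using div_reg_expansion[OF p'(1) False p'(2)] by metis
    define m where "m = nat (n1 - n0)"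
    have m: "Poly_Mapping.lookup d' (Suc j) = int m" using le p1(4) by (simp add: m_def)
    obtain K where "(dd_step n j ^^ K) (xy_coeff (Suc j) 0 (int m) ?p1) \<in> laurent n 0"
      using IH[OF laurent_xy_coeff[OF p1(1)] hom_deg_xy_coeff[OF p1(2)]] by blast
    then obtain k where "(dd_step n (Suc j) ^^ k) ?p1 \<in> laurent n 0"
      using dd_terminates_nonneg[of n j, OF _ Suc.prems(1) p1(1-3) m] IH by blast
    moreover have "dd_step n (Suc j) p = ?p1" using False by (simp add: dd_step_def)
    ultimately have "(dd_step n (Suc j) ^^ Suc k) p \<in> laurent n 0"
      by (simp only: funpow_Suc_right o_apply)
    then show ?thesis by blast
  qed
qed

section \<open>The starting polynomial and the end of its sequence\<close>

lemma hom_deg_sum_single: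
  assumes "finite A" "A \<inter> B = {}" "finite B"
  shows "hom_deg (\<Sum>i\<in>A \<union> B. Poly_Mapping.single i 1)
    ((\<Prod>i\<in>A. xpow i 1) * (\<Prod>i\<in>B. ypow i 1))"
  using assms
  by (simp add: sum.union_disjoint hom_deg_mult hom_deg_prod hom_deg_xpow hom_deg_ypow)

lemma laurent_dd_poly: "dd_poly n \<in> laurent n n"
  unfolding dd_poly_def diff_conv_add_uminus
  by (intro laurent_mult laurent_const laurent_sum laurent_prod laurent_xpow laurent_ypow
    coeff_ring_add coeff_ring_minus coeff_ring_Dlt) auto

text \<open>For every positive \<open>i < n\<close> each summand contains exactly one of
  \<open>x\<^sub>i\<close> and \<open>y\<^sub>i\<close>.\<close>

lemma hom_deg_dd_poly: "hom_deg (\<Sum>i=1..<n. Poly_Mapping.single i 1) (dd_poly n)"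
proof -
  have "hom_deg (0 + (\<Sum>i=1..<n. Poly_Mapping.single i 1))
      (const (Dlt j - Dlt (j - 1)) * ((\<Prod>i=1..<j. xpow i 1) * (\<Prod>i=j..<n. ypow i 1)))"
    if "j \<in> {1..n}" for j
  proof (intro hom_deg_mult hom_deg_const)
    have "{1..<j} \<union> {j..<n} = {1..<n}" using that by auto
    then show "hom_deg (\<Sum>i=1..<n. Poly_Mapping.single i 1)
        ((\<Prod>i=1..<j. xpow i 1) * (\<Prod>i=j..<n. ypow i 1))"
      using hom_deg_sum_single[of "{1..<j}" "{j..<n}"] by auto
  qed
  then have "hom_deg (0 + (\<Sum>i=1..<n. Poly_Mapping.single i 1)) (dd_poly n)"
    unfolding dd_poly_def by (intro hom_deg_mult hom_deg_const hom_deg_sum) (simp add: mult.assoc)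
  then show ?thesis by simp
qed

text \<open>Termination ensures that the \<open>LEAST\<close> in \<open>DD_of\<close> is
  attained.\<close>

lemma dd_seq_DD: "dd_seq n (dd_poly n) (DD n) \<in> laurent n 0"
  unfolding DD_def DD_of_def dd_seq_eq_funpow
  using dd_terminates[OF order.refl laurent_dd_poly hom_deg_dd_poly] by (rule LeastI_ex)

section \<open>The functions \<open>g_seq\<close> and their derivatives\<close>

text \<open>Power maps are monotone or antimonotone on the positive reals, so by induction the same
  holds for each \<open>g_seq a r i\<close> between \<open>x\<close> and \<open>y\<close>. Its
  values are then bounded below by one at an endpoint, which is positive, and the induction can go
  on.\<close>

lemma g_seq_mono_or_antimono:
  assumes "x \<in> dom_int n a r" "y \<in> dom_int n a r" "x \<le> y" "i \<le> n"
  shows "(\<forall>z\<in>{x..y}. \<forall>j\<le>i. g_seq a r j z > 0) \<and>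
    (mono_on {x..y} (g_seq a r i) \<or> monotone_on {x..y} (\<le>) (\<ge>) (g_seq a r i))"
  using assms(4)
proof (induction i)
  case 0
  then show ?case using assms by (auto simp: dom_int_def mono_on_def)
next
  case (Suc i)
  let ?g = "g_seq a r i" and ?g' = "g_seq a r (Suc i)"
  have pos: "?g z > 0" if "z \<in> {x..y}" for z using Suc that by auto
  have mono: "mono_on {x..y} ?g' \<or> monotone_on {x..y} (\<le>) (\<ge>) ?g'"
  proof (cases "r (Suc i) \<ge> 0")
    case True
    then show ?thesis using Suc.IH Suc.prems pos
      by (auto simp: monotone_on_def less_imp_le intro!: powr_mono2)
  next
    case False
    then show ?thesis using Suc.IH Suc.prems pos
      by (auto simp: monotone_on_def less_imp_le intro!: powr_mono2')
  qed
  have "?g' x > 0" "?g' y > 0" using assms Suc.prems unfolding dom_int_def by blast+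
  have "?g' z > 0" if "z \<in> {x..y}" for z
  proof -
    have "?g' x \<le> ?g' z \<or> ?g' y \<le> ?g' z"
      using mono that assms(3) unfolding monotone_on_def
      by (meson atLeastAtMost_iff order.refl)
    then show ?thesis using \<open>?g' x > 0\<close> \<open>?g' y > 0\<close> by linarith
  qed
  moreover have "\<forall>z\<in>{x..y}. \<forall>j\<le>i. g_seq a r j z > 0" using Suc by auto
  ultimately show ?case using mono unfolding le_Suc_eq by blast
qed

lemma is_interval_dom_int: "is_interval (dom_int n a r)"
  unfolding is_interval_1
proof (intro allI ballI impI)
  fix x y z assume xy: "x \<in> dom_int n a r" "y \<in> dom_int n a r" and z: "x \<le> z \<and> z \<le> y"
  have "\<forall>z\<in>{x..y}. \<forall>j\<le>n. g_seq a r j z > 0"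
    using g_seq_mono_or_antimono[OF xy _ order.refl] z by (meson order.trans)
  then show "z \<in> dom_int n a r" using z by (simp add: dom_int_def)
qed

section \<open>Logarithms of the variables, elasticities and derivatives\<close>

abbreviation log_x :: "(nat \<Rightarrow> real) \<Rightarrow> (nat \<Rightarrow> real) \<Rightarrow> nat \<Rightarrow> real \<Rightarrow> real" where
  "log_x a r i x \<equiv> r i * ln (g_seq a r (i - 1) x)"

abbreviation log_y :: "(nat \<Rightarrow> real) \<Rightarrow> (nat \<Rightarrow> real) \<Rightarrow> nat \<Rightarrow> real \<Rightarrow> real" where
  "log_y a r i x \<equiv> ln (g_seq a r i x)"

text \<open>\<open>elast a r i x\<close> is the elasticity \<open>x g\<^sub>i'(x) / g\<^sub>i(x)\<close>.\<close>

definition elast :: "(nat \<Rightarrow> real) \<Rightarrow> (nat \<Rightarrow> real) \<Rightarrow> nat \<Rightarrow> real \<Rightarrow> real" where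
  "elast a r i x = (\<Prod>t=1..i. r t) * (\<Prod>k=1..i. exp (log_x a r k x - log_y a r k x))"

text \<open>From \<open>i\<close> to \<open>Suc i\<close> the chain rule multiplies the elasticity
  by \<open>r (Suc i)\<close> and by the quotient of the values of
  \<open>x\<^sub>i\<^sub>+\<^sub>1\<close> and \<open>y\<^sub>i\<^sub>+\<^sub>1\<close>.\<close>

lemma has_derivative_g_seq:
  assumes "\<And>j. j \<le> i \<Longrightarrow> g_seq a r j x > 0"
  shows "(g_seq a r i has_real_derivative elast a r i x * g_seq a r i x / x) (at x)"
  using assms
proof (induction i)
  case 0
  then show ?case using DERIV_ident by (auto simp: elast_def)
next
  case (Suc i)
  let ?g = "g_seq a r i x" and ?g' = "g_seq a r (Suc i) x"
  have pos: "?g > 0" "?g' > 0" using Suc.prems[of i] Suc.prems[of "Suc i"] by auto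
  have "((\<lambda>x. a (Suc i) + g_seq a r i x powr r (Suc i)) has_real_derivative
    r (Suc i) * ?g powr (r (Suc i) - 1) * (elast a r i x * ?g / x)) (at x)"
    using Suc.IH Suc.prems pos
    by (auto intro!: derivative_eq_intros)
  moreover have "r (Suc i) * ?g powr (r (Suc i) - 1) * (elast a r i x * ?g / x) =
      elast a r (Suc i) x * ?g' / x"
  proof -
    have "elast a r (Suc i) x * ?g' = elast a r i x * r (Suc i) * ?g powr r (Suc i)"
      using pos by (simp add: elast_def exp_diff powr_def del: g_seq.simps)
    also have "?g powr r (Suc i) = ?g powr (r (Suc i) - 1) * ?g"
      using pos by (simp add: powr_diff)
    finally show ?thesis by simp
  qed
  ultimately show ?case by (simp only: g_seq.simps)
qed

section \<open>Counting solutions\<close>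

definition path_eval :: "nat \<Rightarrow> (nat \<Rightarrow> real) \<Rightarrow> (nat \<Rightarrow> real) \<Rightarrow> laur \<Rightarrow> real \<Rightarrow> real" where
  "path_eval n a r p x = laur_eval n r (\<lambda>i. log_x a r i x) (\<lambda>i. log_y a r i x) p"

lemma elast_Suc:
  "elast a r (Suc i) x = elast a r i x * r (Suc i) * exp (log_x a r (Suc i) x - log_y a r (Suc i) x)"
  by (simp add: elast_def del: g_seq.simps)

lemma has_derivative_log_y:
  assumes x: "x \<in> dom_int n a r" and i: "i \<le> n"
  shows "((\<lambda>x. log_y a r i x) has_real_derivative elast a r i x / x) (at x)"
proof -
  have pos: "g_seq a r j x > 0" if "j \<le> i" for j using x i that by (simp add: dom_int_def)
  have "((\<lambda>x. log_y a r i x) has_real_derivative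
      elast a r i x * g_seq a r i x / x / g_seq a r i x) (at x)"
    using has_derivative_g_seq[of i a r x] pos[OF order.refl] pos by (auto intro!: derivative_eq_intros)
  then show ?thesis using pos[OF order.refl] by simp
qed

lemma has_derivative_path_eval:
  assumes x: "x \<in> dom_int n a r"
  shows "(path_eval n a r p has_real_derivative path_eval n a r (dd_deriv n p) x / x) (at x)"
proof -
  have pos: "g_seq a r i x > 0" if "i \<le> n" for i using x that by (simp add: dom_int_def)
  have x0: "x > 0" using pos[of 0] by simp
  \<comment> \<open>The right side is \<open>x\<close> times the derivative of the value of
    \<open>x\<^sub>i\<^sub>+\<^sub>1\<close>, and equally of
    \<open>y\<^sub>i\<^sub>+\<^sub>1\<close>, which differs from it by the constant
    \<open>a (Suc i)\<close>.\<close>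
  have dvar: "laur_eval n r (\<lambda>i. log_x a r i x) (\<lambda>i. log_y a r i x) (dvar (Suc i)) =
      elast a r i x * r (Suc i) * exp (log_x a r (Suc i) x)" if "Suc i \<le> n" for i
    using that by (subst laur_eval_dvar) (simp_all add: elast_def atLeastLessThanSuc_atLeastAtMost)
  show ?thesis unfolding path_eval_def
  proof (rule laur_eval_deriv)
    fix i assume i: "i \<in> {1..n}"
    then obtain k where k: "i = Suc k" by (cases i) auto
    show "((\<lambda>x. log_x a r i x) has_real_derivative r i * (elast a r (i - 1) x / x)) (at x)"
      using i by (intro DERIV_cmult has_derivative_log_y[OF x]) auto
    show "((\<lambda>x. log_y a r i x) has_real_derivative elast a r i x / x) (at x)"
      using i by (intro has_derivative_log_y[OF x]) auto
    show "x * (r i * (elast a r (i - 1) x / x)) =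
        laur_eval n r (\<lambda>i. log_x a r i x) (\<lambda>i. log_y a r i x) (dvar i) * exp (- log_x a r i x)"
      using i x0 unfolding k by (subst dvar) (simp_all add: exp_minus)
    show "x * (elast a r i x / x) =
        laur_eval n r (\<lambda>i. log_x a r i x) (\<lambda>i. log_y a r i x) (dvar i) * exp (- log_y a r i x)"
      using i x0 unfolding k
      by (subst dvar) (simp_all add: elast_Suc exp_diff exp_minus field_simps del: g_seq.simps)
  qed (use x0 in auto)
qed

lemma DERIV_zero_interval_constant:
  fixes u :: "real \<Rightarrow> real"
  assumes "is_interval I" "\<And>x. x \<in> I \<Longrightarrow> (u has_real_derivative 0) (at x)" "x \<in> I" "y \<in> I"
  shows "u x = u y"
proof -
  have "convex I" using assms(1) by (rule is_interval_convex)
  then obtain c where "\<forall>x\<in>I. u x = c"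
    using has_field_derivative_zero_constant[of I u] assms(2) has_field_derivative_at_within by blast
  then show ?thesis using assms by simp
qed

text \<open>On the domain the derivative of a member of the sequence has the zeros of the next
  member, so the induction on \<open>K\<close> peels off the first step. At most
  \<open>K + 1\<close> components result: one in the base case and one more for each use of Rolle's
  theorem.\<close>

lemma not_alternating_dd_seq:
  assumes "dd_seq n p K \<in> laurent n 0"
    and "\<And>x. x \<in> dom_int n a r \<Longrightarrow> (h has_real_derivative h' x) (at x)"
    and "\<And>x. x \<in> dom_int n a r \<Longrightarrow> h' x = 0 \<longleftrightarrow> path_eval n a r p x = 0"
  shows "\<not> alternating {x \<in> dom_int n a r. h x = 0} (Suc (Suc K))"
proof -
  let ?I = "dom_int n a r"
  have I: "is_interval ?I" by (rule is_interval_dom_int)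
  have shift: "dd_seq n p (Suc k) = dd_seq n (dd_seq n p 1) k" for k p
    by (induction k) (simp_all add: Let_def)
  show ?thesis using assms
  proof (induction K arbitrary: p h h')
    case 0
    \<comment> \<open>The equality holds outside the domain too, so \<open>1\<close> can serve as
      the reference point below.\<close>
    have const: "path_eval n a r p x = path_eval n a r p y" for x y
      unfolding path_eval_def using 0(1) by (intro laur_eval_laurent_0) simp
    show ?case
    proof (cases "path_eval n a r p 1 = 0")
      case True
      then have "(h has_real_derivative 0) (at x)" if "x \<in> ?I" for x
        using 0(2,3)[OF that] const[of x 1] by simp
      then have "h x = h y" if "x \<in> ?I" "y \<in> ?I" for x y
        using DERIV_zero_interval_constant[OF I] that by blast
      then show ?thesis using not_alternating_constant[OF I] by blast
    next
      case False
      then have empty: "{x \<in> ?I. path_eval n a r p x = 0} = {}"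
      proof -
        have "path_eval n a r p x \<noteq> 0" for x using False const[of x 1] by simp
        then show ?thesis by simp
      qed
      have "\<not> alternating {x \<in> ?I. path_eval n a r p x = 0} 1"
        unfolding empty alternating_def by simp
      then show ?thesis
        using not_alternating_derivative[OF I 0(2,3), of 1] by simp
    qed
  next
    case (Suc K)
    have "\<not> alternating {x \<in> ?I. path_eval n a r p x = 0} (Suc (Suc K))"
    proof (rule Suc.IH)
      show "dd_seq n (dd_seq n p 1) K \<in> laurent n 0" using Suc.prems(1) shift by metis
      fix x assume x: "x \<in> ?I"
      show "(path_eval n a r p has_real_derivative path_eval n a r (dd_deriv n p) x / x) (at x)"
        using x by (rule has_derivative_path_eval)
      have "x > 0" using x by (force simp: dom_int_def)
      moreover have "path_eval n a r (dd_deriv n p) x = 0 \<longleftrightarrow> path_eval n a r (dd_seq n p 1) x = 0"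
      proof (cases "dd_deriv n p = 0")
        case False
        then show ?thesis
          using laur_eval_div_reg[of n r _ _ "dd_deriv n p" n]
          by (simp add: path_eval_def mon_eval_def Let_def)
      qed (simp add: Let_def)
      ultimately show "path_eval n a r (dd_deriv n p) x / x = 0 \<longleftrightarrow>
          path_eval n a r (dd_seq n p 1) x = 0" by simp
    qed
    then show ?case
      using not_alternating_derivative[OF I Suc.prems(2,3)] by blast
  qed
qed

text \<open>Pulling the product of all \<open>y\<^sub>i\<close> out of summand \<open>j\<close>
  leaves the quotients of \<open>x\<^sub>i\<close> by \<open>y\<^sub>i\<close> for
  \<open>i < j\<close>. The coefficient \<open>Dlt j - Dlt (j - 1)\<close> evaluates to
  \<open>r j - 1\<close> times the product of the earlier exponents, which completes
  \<open>elast a r (j - 1) x\<close>.\<close>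

lemma path_eval_dd_poly:
  assumes x: "x \<in> dom_int n a r"
  shows "path_eval n a r (dd_poly n) x =
    (\<Prod>t=1..n. r t) * (\<Prod>i=1..<n. g_seq a r i x) * (\<Sum>j=1..n. (r j - 1) * elast a r (j - 1) x)"
proof -
  let ?A = "\<lambda>i. log_x a r i x" and ?B = "\<lambda>i. log_y a r i x"
  have pos: "g_seq a r i x > 0" if "i \<le> n" for i using x that by (simp add: dom_int_def)
  have P: "(\<Prod>i=1..<n. g_seq a r i x) = (\<Prod>i=1..<n. exp (?B i))"
    by (intro prod.cong) (auto simp: pos)
  have "laur_eval n r ?A ?B (const (Dlt j - Dlt (j - 1)) * (\<Prod>i=1..<j. xpow i 1) * (\<Prod>i=j..<n. ypow i 1)) =
      (\<Prod>i=1..<n. g_seq a r i x) * ((r j - 1) * elast a r (j - 1) x)" if j: "j \<in> {1..n}" for j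
  proof -
    obtain k where k: "j = Suc k" using j by (cases j) auto
    have split: "(\<Prod>i=1..<n. exp (?B i)) = (\<Prod>i=1..k. exp (?B i)) * (\<Prod>i=j..<n. exp (?B i))"
      using j prod.atLeastLessThan_concat[of 1 j n "\<lambda>i. exp (?B i)"]
      by (simp add: k atLeastLessThanSuc_atLeastAtMost)
    have "laur_eval n r ?A ?B (\<Prod>i=1..<j. xpow i 1) = (\<Prod>i=1..k. exp (?A i))"
      unfolding laur_eval_prod using j
      by (intro prod.cong) (auto simp: k laur_eval_xpow atLeastLessThanSuc_atLeastAtMost)
    also have "\<dots> = (\<Prod>i=1..k. exp (?A i - ?B i)) * (\<Prod>i=1..k. exp (?B i))"
      by (simp add: prod.distrib[symmetric] exp_diff)
    finally have X: "laur_eval n r ?A ?B (\<Prod>i=1..<j. xpow i 1) =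
        (\<Prod>i=1..k. exp (?A i - ?B i)) * (\<Prod>i=1..k. exp (?B i))" .
    have Y: "laur_eval n r ?A ?B (\<Prod>i=j..<n. ypow i 1) = (\<Prod>i=j..<n. exp (?B i))"
      unfolding laur_eval_prod using j by (intro prod.cong) (auto simp: laur_eval_ypow)
    have D: "coeff_eval n r (Dlt j - Dlt (j - 1)) = (\<Prod>t=1..k. r t) * (r j - 1)"
      using j by (simp add: k coeff_eval_Dlt algebra_simps)
    show ?thesis
      unfolding laur_eval_mult laur_eval_const X Y D P split
      by (simp add: k elast_def algebra_simps)
  qed
  then show ?thesis
    unfolding path_eval_def dd_poly_def laur_eval_mult laur_eval_sum laur_eval_const
    by (simp add: coeff_eval_Dlt sum_distrib_left mult.assoc)
qed

text \<open>The left side is the derivative of \<open>g_seq a r i\<close>, the right side its chain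
  rule expansion with all powers collected in one exponential, ready for taking logarithms.\<close>

lemma elast_eq_prod_powr:
  assumes x: "x \<in> dom_int n a r" and "i \<le> n"
  shows "elast a r i x * g_seq a r i x / x = (\<Prod>t=1..i. r t) * exp (\<Sum>k=1..i. (r k - 1) * log_y a r (k - 1) x)"
  using assms(2)
proof (induction i)
  case 0
  have "x > 0" using x by (force simp: dom_int_def)
  then show ?case by (simp add: elast_def)
next
  case (Suc i)
  have pos: "g_seq a r i x > 0" if "i \<le> n" for i using x that by (simp add: dom_int_def)
  have "elast a r (Suc i) x * g_seq a r (Suc i) x / x =
      (elast a r i x * g_seq a r i x / x) * (r (Suc i) * exp ((r (Suc i) - 1) * log_y a r i x))"
    using pos[of i] pos[of "Suc i"] Suc.prems
    by (simp add: elast_Suc exp_diff left_diff_distrib field_simps del: g_seq.simps)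
  also have "elast a r i x * g_seq a r i x / x =
      (\<Prod>t=1..i. r t) * exp (\<Sum>k=1..i. (r k - 1) * log_y a r (k - 1) x)"
    using Suc by simp
  finally show ?case by (simp add: exp_add del: g_seq.simps)
qed

text \<open>For \<open>D > 0\<close> Rolle's theorem leads from the equation to \<open>h\<close>,
  whose zero set has at most \<open>K + 1\<close> components; this step adds one.\<close>

lemma not_alternating_solutions:
  assumes "b > 0" and K: "dd_seq n (dd_poly n) K \<in> laurent n 0"
  shows "\<not> alternating (sol_set n b a r) (Suc (K + 2))"
proof -
  let ?I = "dom_int n a r"
  let ?f = "\<lambda>x. g_seq a r n x - b * x"
  define D where "D = (\<Prod>t=1..n. r t)"
  define L where "L x = (\<Sum>k=1..n. (r k - 1) * log_y a r (k - 1) x)" for x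
  have I: "is_interval ?I" by (rule is_interval_dom_int)
  have pos: "g_seq a r i x > 0" if "x \<in> ?I" "i \<le> n" for i x using that by (simp add: dom_int_def)
  have df: "(?f has_real_derivative (D * exp (L x) - b)) (at x)" if "x \<in> ?I" for x
  proof -
    have "(g_seq a r n has_real_derivative D * exp (L x)) (at x)"
      using has_derivative_g_seq[of n a r x] pos[OF that] elast_eq_prod_powr[OF that order.refl]
      by (simp add: D_def L_def)
    then show ?thesis by (auto intro!: derivative_eq_intros)
  qed
  have "\<not> alternating {x \<in> ?I. ?f x = 0} (Suc (Suc (Suc K)))"
  proof (cases "D > 0")
    case False
    \<comment> \<open>The derivative is negative, so the constant function \<open>1\<close> can
      stand in for it as \<open>v\<close>.\<close>
    then have "D * exp (L x) - b \<noteq> 0" for x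
      using \<open>b > 0\<close> mult_nonpos_nonneg[of D "exp (L x)"] by auto
    then have "\<not> alternating {x \<in> ?I. ?f x = 0} (Suc 1)"
      by (intro not_alternating_derivative[OF I df, where v = "\<lambda>x. 1 :: real"])
        (simp_all add: alternating_def)
    then show ?thesis using alternating_mono by fastforce
  next
    case True
    define h where "h x = L x + ln D - ln b" for x
    let ?h' = "\<lambda>x. (\<Sum>k=1..n. (r k - 1) * (elast a r (k - 1) x / x))"
    have dh: "(h has_real_derivative ?h' x) (at x)" if x: "x \<in> ?I" for x
    proof -
      have "(L has_real_derivative ?h' x) (at x)"
        unfolding L_def by (intro DERIV_sum DERIV_cmult has_derivative_log_y[OF x]) auto
      then show ?thesis unfolding h_def by (auto intro!: derivative_eq_intros)
    qed
    have zero: "?h' x = 0 \<longleftrightarrow> path_eval n a r (dd_poly n) x = 0" if x: "x \<in> ?I" for x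
    proof -
      have "x > 0" using pos[OF x, of 0] by simp
      moreover have "?h' x = (\<Sum>k=1..n. (r k - 1) * elast a r (k - 1) x) / x"
        by (simp add: sum_divide_distrib)
      moreover have "(\<Prod>i=1..<n. g_seq a r i x) > 0" using pos[OF x] by (intro prod_pos) auto
      ultimately show ?thesis
        using True by (simp add: path_eval_dd_poly[OF x] D_def del: One_nat_def prod_zero_iff)
    qed
    have h: "\<not> alternating {x \<in> ?I. h x = 0} (Suc (Suc K))"
      by (rule not_alternating_dd_seq[OF K, where h' = ?h']) (fact dh zero)+
    \<comment> \<open>Both \<open>D * exp (L x)\<close> and \<open>b\<close> are positive, so they
      agree exactly when their logarithms do.\<close>
    have "D * exp (L x) - b = 0 \<longleftrightarrow> h x = 0" for x
    proof -
      have "D * exp (L x) - b = 0 \<longleftrightarrow> ln (D * exp (L x)) = ln b"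
        using True \<open>b > 0\<close> by simp
      also have "\<dots> \<longleftrightarrow> h x = 0" using True by (auto simp: h_def ln_mult)
      finally show ?thesis .
    qed
    then show ?thesis by (intro not_alternating_derivative[OF I df _ h])
  qed
  then show ?thesis by (simp add: sol_set_def)
qed

theorem corollary2p3:
  fixes n :: nat
  assumes "n \<ge> 1"
  shows "fp n \<le> enat (DD n + 2)"
  unfolding fp_def
proof (rule Sup_least)
  fix c assume "c \<in> {num_components (sol_set n b a r) | b a r. b > 0}"
  then obtain b a r where "c = num_components (sol_set n b a r)" "b > 0" by blast
  then show "c \<le> enat (DD n + 2)"
    using num_components_le[OF not_alternating_solutions[OF _ dd_seq_DD]] by blast
qed

end
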